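(* Let $\mu,\nu\in\mathcal{P}^1(\mathbb{P}_m)$. If $\mu\le\nu$, then $G(\mu)\le G(\nu)$.
   Context: $\mathbb{P}_m$ is the set of $m\times m$ (complex Hermitian) positive definite matrices, with the Riemannian trace metric $d(A,B)=\|\log A^{-1/2}BA^{-1/2}\|_2$, where $\|X\|_2=(\operatorname{tr}X^2)^{1/2}$ for Hermitian $X$; its topology coincides with the Euclidean one. For Hermitian matrices, $A\le B$ means that $B-A$ is positive semidefinite. $\mathcal{P}^1(\mathbb{P}_m)$ is the set of Borel probability measures $\mu$ on $\mathbb{P}_m$ with $\int d(X,Y)\,d\mu(X)<\infty$ for some (equivalently, all) $Y\in\mathbb{P}_m$. Cartan barycenter: for $\mu\in\mathcal{P}^1(\mathbb{P}_m)$, $G(\mu)$ is the unique minimizer over $Z\in\mathbb{P}_m$ of $\int_{\mathbb{P}_m}[d^2(Z,X)-d^2(Y,X)]\,d\mu(X)$, where $Y\in\mathbb{P}_m$ is fixed; the minimizer exists, is unique, and does not depend on $Y$. Stochastic order: a set $\mathcal{U}\subset\mathbb{P}_m$ is an upper set if $\mathcal{U}=\{B\in\mathbb{P}_m: A\le B\text{ for some }A\in\mathcal{U}\}$. For Borel probability measures $\mu,\nu$ on $\mathbb{P}_m$, $\mu\le\nu$ means $\mu(\mathcal{U})\le\nu(\mathcal{U})$ for all open upper sets $\mathcal{U}\subset\mathbb{P}_m$. *)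

theory Defs
  imports "HOL-Probability.Probability"
begin

definition conj_transpose :: "complex^'n^'m \<Rightarrow> complex^'m^'n" where
  "conj_transpose A = map_matrix cnj (transpose A)"

definition hermitian :: "complex^'n^'n \<Rightarrow> bool" where
  "hermitian A \<longleftrightarrow> conj_transpose A = A"

text \<open>The real inner product on the type \<open>complex^'n\<close> is the real part of the standard
  Hermitian one; for Hermitian \<open>A\<close>, \<open>x \<bullet> (A *v x)\<close> is therefore exactly \<open>x\<^sup>* A x\<close>.\<close>

definition psd :: "complex^'n^'n \<Rightarrow> bool" where
  "psd A \<longleftrightarrow> hermitian A \<and> (\<forall>x. 0 \<le> x \<bullet> (A *v x))"

definition pd_matrices :: "(complex^'n^'n) set" where
  "pd_matrices = {A. hermitian A \<and> (\<forall>x. x \<noteq> 0 \<longrightarrow> 0 < x \<bullet> (A *v x))}"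

definition loewner_le :: "complex^'n^'n \<Rightarrow> complex^'n^'n \<Rightarrow> bool" where
  "loewner_le A B \<longleftrightarrow> psd (B - A)"

definition unitary :: "complex^'n^'n \<Rightarrow> bool" where
  "unitary U \<longleftrightarrow> conj_transpose U ** U = mat 1 \<and> U ** conj_transpose U = mat 1"

definition real_diag :: "real^'n \<Rightarrow> complex^'n^'n" where
  "real_diag d = (\<chi> i j. if i = j then complex_of_real (d $ i) else 0)"

text \<open>Functional calculus for Hermitian matrices: \<open>f(U diag(d) U\<^sup>*) = U diag(f(d)) U\<^sup>*\<close>.
  By the spectral theorem every Hermitian matrix has such a representation, and the result
  does not depend on the one chosen.\<close>

definition hermitian_fun :: "(real \<Rightarrow> real) \<Rightarrow> complex^'n^'n \<Rightarrow> complex^'n^'n" where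
  "hermitian_fun f A = (THE B. \<exists>U d. unitary U \<and>
      A = U ** real_diag d ** conj_transpose U \<and>
      B = U ** real_diag (\<chi> i. f (d $ i)) ** conj_transpose U)"

definition matrix_ln :: "complex^'n^'n \<Rightarrow> complex^'n^'n" where
  "matrix_ln A = hermitian_fun ln A"

definition matrix_powr :: "complex^'n^'n \<Rightarrow> real \<Rightarrow> complex^'n^'n" where
  "matrix_powr A p = hermitian_fun (\<lambda>t. t powr p) A"

definition hs_norm :: "complex^'n^'n \<Rightarrow> real" where
  "hs_norm X = sqrt (Re (trace (X ** X)))"

definition trace_dist :: "complex^'n^'n \<Rightarrow> complex^'n^'n \<Rightarrow> real" where
  "trace_dist A B = hs_norm (matrix_ln (matrix_powr A (-1/2) ** B ** matrix_powr A (-1/2)))"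

text \<open>The topology of the trace metric on \<open>pd_matrices\<close> is the Euclidean subspace topology,
  so Borel and open sets below are those of the latter.\<close>

definition borel_prob_pd :: "(complex^'n^'n) measure set" where
  "borel_prob_pd = {\<mu>. prob_space \<mu> \<and> sets \<mu> = sets (restrict_space borel pd_matrices)}"

definition P1_pd :: "(complex^'n^'n) measure set" where
  "P1_pd = {\<mu> \<in> borel_prob_pd. \<exists>Y\<in>pd_matrices. integrable \<mu> (\<lambda>X. trace_dist X Y)}"

definition cartan_minimizer ::
  "complex^'n^'n \<Rightarrow> (complex^'n^'n) measure \<Rightarrow> complex^'n^'n \<Rightarrow> bool" where
  "cartan_minimizer Y \<mu> Z \<longleftrightarrow> Z \<in> pd_matrices \<and>
     (\<forall>W\<in>pd_matrices.
        (\<integral>X. ((trace_dist Z X)\<^sup>2 - (trace_dist Y X)\<^sup>2) \<partial>\<mu>) \<le>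
        (\<integral>X. ((trace_dist W X)\<^sup>2 - (trace_dist Y X)\<^sup>2) \<partial>\<mu>))"

text \<open>For \<open>\<mu> \<in> P1_pd\<close> the minimizer is the same for every base point \<open>Y\<close>, so no particular
  \<open>Y\<close> is singled out.\<close>

definition cartan_barycenter :: "(complex^'n^'n) measure \<Rightarrow> complex^'n^'n" where
  "cartan_barycenter \<mu> = (THE Z. \<forall>Y\<in>pd_matrices. cartan_minimizer Y \<mu> Z)"

definition upper_pd_set :: "(complex^'n^'n) set \<Rightarrow> bool" where
  "upper_pd_set U \<longleftrightarrow> U = {B \<in> pd_matrices. \<exists>A\<in>U. loewner_le A B}"

definition stochastic_le :: "(complex^'n^'n) measure \<Rightarrow> (complex^'n^'n) measure \<Rightarrow> bool" where
  "stochastic_le \<mu> \<nu> \<longleftrightarrow>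
     (\<forall>U. openin (top_of_set pd_matrices) U \<and> upper_pd_set U \<longrightarrow> measure \<mu> U \<le> measure \<nu> U)"

end

theory Submission imports Defs begin

text \<open>Write \<open>log\<^sub>Z X = Z\<^sup>1\<^sup>/\<^sup>2 log(Z\<^sup>-\<^sup>1\<^sup>/\<^sup>2 X Z\<^sup>-\<^sup>1\<^sup>/\<^sup>2) Z\<^sup>1\<^sup>/\<^sup>2\<close>.
  First variation of the squared distance shows that a minimizer \<open>Z\<close> for \<open>\<mu>\<close> satisfies the Karcher
  equation \<open>\<integral> log\<^sub>Z X d\<mu>(X) = 0\<close>.  Let \<open>W\<close> be a minimizer for \<open>\<nu>\<close>.  Since \<open>log\<^sub>Z X\<close> is monotone in
  \<open>X\<close>, the layer cake formula gives \<open>\<integral> log\<^sub>Z X d\<nu>(X) \<ge> 0\<close>.  If \<open>Z \<le> W\<close> failed, the least \<open>c\<close> with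
  \<open>Z \<le> c W\<close> would satisfy \<open>c > 1\<close>, with \<open>Z y = c W y\<close> for some \<open>y \<noteq> 0\<close>.  On such a contact vector the
  relative logarithm is monotone in the base point (a Kamke condition), so
  \<open>y\<^sup>* (log\<^sub>Z X) y \<le> y\<^sup>* (log\<^bsub>cW\<^esub> X) y = c y\<^sup>* (log\<^sub>W X) y - c ln c y\<^sup>* W y\<close>; integrating
  against \<open>\<nu>\<close> gives \<open>0 \<le> - c ln c y\<^sup>* W y < 0\<close>.  With \<open>\<mu> = \<nu>\<close> the same argument yields uniqueness of
  the minimizer; existence follows from properness of the metric.\<close>

subsection \<open>Adjoints and the spectral theorem\<close>

text \<open>A first moment makes the distance integrable, but perhaps not its square. Differences of
  squared distances grow only linearly in the distance, so the variational arguments integrate such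
  differences; the same linear bound dominates the difference quotients behind the Karcher equation.
  Noncommutativity obstructs the calculus. Inner products of f(A) with g(B) are weighted sums over
  pairs of eigenvalues, with weights independent of f and g, so continuity of the logarithm and the
  derivative of the squared distance reduce to estimates for \<open>ln\<close> on the positive
  reals. The triangle inequality then comes from a speed bound for the distance along a geodesic.
  Contact vectors enter because the base point occurs twice in the relative logarithm, in the outer
  square roots and in the inner inverse ones, and the two effects may oppose each other. In the
  variational form the base point is seen through Z y and through its form at the minimisation
  vector; fixing Z y leaves only the increasing dependence.\<close>

abbreviation adj :: "complex^'n^'m \<Rightarrow> complex^'m^'n" where
  "adj \<equiv> conj_transpose"

lemma adj_nth [simp]: "adj A $ i $ j = cnj (A $ j $ i)"
  by (simp add: conj_transpose_def transpose_def)

lemma adj_adj [simp]: "adj (adj A) = A"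
  by (simp add: vec_eq_iff)

lemma adj_mult: "adj (A ** B) = adj B ** adj A"
  by (simp add: vec_eq_iff matrix_matrix_mult_def mult.commute)

lemma adj_mat1 [simp]: "adj (mat 1) = mat 1"
  by (simp add: vec_eq_iff mat_def)

lemma adj_add: "adj (A + B) = adj A + adj B"
  by (simp add: vec_eq_iff)

lemma adj_diff: "adj (A - B) = adj A - adj B"
  by (simp add: vec_eq_iff)

lemma adj_scaleR: "adj (r *\<^sub>R A) = r *\<^sub>R adj A"
  by (simp add: vec_eq_iff)

lemma mult_scaleR_left: "(r *\<^sub>R A) ** B = r *\<^sub>R (A ** B)"
  for A :: "complex^'n^'m" and B :: "complex^'k^'n"
  by (simp add: vec_eq_iff matrix_matrix_mult_def scaleR_sum_right)

lemma mult_scaleR_right: "A ** (r *\<^sub>R B) = r *\<^sub>R (A ** B)"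
  for A :: "complex^'n^'m" and B :: "complex^'k^'n"
  by (simp add: vec_eq_iff matrix_matrix_mult_def scaleR_sum_right)

lemma scaleR_mult_vec: "(r *\<^sub>R A) *v x = r *\<^sub>R (A *v x)"
  for A :: "complex^'n^'m"
  by (simp add: vec_eq_iff matrix_vector_mult_def scaleR_sum_right)

lemma mult_vec_scaleR: "A *v (r *\<^sub>R x) = r *\<^sub>R (A *v x)"
  for A :: "complex^'n^'m"
  by (simp add: vec_eq_iff matrix_vector_mult_def scaleR_sum_right)

lemma complex_inner_Re: "(x::complex) \<bullet> y = Re (cnj x * y)"
  by (simp add: inner_complex_def)

lemma inner_adj: "x \<bullet> (A *v y) = (adj A *v x) \<bullet> y"
proof -
  have "x \<bullet> (A *v y) = (\<Sum>i\<in>UNIV. \<Sum>j\<in>UNIV. Re (cnj (x$i) * (A$i$j * y$j)))"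
    by (simp only: inner_vec_def complex_inner_Re matrix_vector_mult_def vec_lambda_beta
        sum_distrib_left Re_sum)
  also have "\<dots> = (\<Sum>j\<in>UNIV. \<Sum>i\<in>UNIV. Re (cnj (x$i) * (A$i$j * y$j)))"
    by (rule sum.swap)
  also have "\<dots> = (adj A *v x) \<bullet> y"
    by (simp only: inner_vec_def complex_inner_Re matrix_vector_mult_def vec_lambda_beta
        sum_distrib_left sum_distrib_right Re_sum adj_nth cnj_sum complex_cnj_mult complex_cnj_cnj mult_ac)
  finally show ?thesis .
qed

lemma matrix_inner_trace: "A \<bullet> B = Re (trace (adj A ** B))" for A B :: "complex^'n^'m"
proof -
  have "A \<bullet> B = (\<Sum>i\<in>UNIV. \<Sum>j\<in>UNIV. Re (cnj (A$i$j) * (B$i$j)))"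
    by (simp only: inner_vec_def complex_inner_Re)
  also have "\<dots> = (\<Sum>j\<in>UNIV. \<Sum>i\<in>UNIV. Re (cnj (A$i$j) * (B$i$j)))"
    by (rule sum.swap)
  also have "\<dots> = Re (trace (adj A ** B))"
    by (simp only: trace_def matrix_matrix_mult_def vec_lambda_beta adj_nth Re_sum)
  finally show ?thesis .
qed

lemma inner_mult_left: "(A ** B) \<bullet> C = B \<bullet> (adj A ** C)"
  for A :: "complex^'n^'m" and B :: "complex^'k^'n"
  by (simp add: matrix_inner_trace adj_mult matrix_mul_assoc)

lemma inner_mult_right: "(A ** B) \<bullet> C = A \<bullet> (C ** adj B)"
  for A :: "complex^'n^'m" and B :: "complex^'k^'n"
  unfolding matrix_inner_trace adj_mult
  by (metis matrix_mul_assoc trace_mul_sym)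

lemma hermitianD: "hermitian A \<Longrightarrow> adj A = A"
  by (simp add: hermitian_def)

lemma hermitian_inner: "hermitian A \<Longrightarrow> x \<bullet> (A *v y) = (A *v x) \<bullet> y"
  by (simp add: inner_adj hermitian_def)

lemma hermitian_diff: "hermitian A \<Longrightarrow> hermitian B \<Longrightarrow> hermitian (A - B)"
  and hermitian_scaleR: "hermitian A \<Longrightarrow> hermitian (r *\<^sub>R A)"
  and hermitian_congr: "hermitian A \<Longrightarrow> hermitian (adj K ** A ** K)"
  by (simp_all add: hermitian_def adj_diff adj_scaleR adj_mult matrix_mul_assoc)

lemma hermitian_mat1 [simp]: "hermitian (mat 1)"
  by (simp add: hermitian_def)

lemma hs_norm_eq_norm: "hermitian A \<Longrightarrow> hs_norm A = norm A"
  by (simp add: hs_norm_def norm_eq_sqrt_inner matrix_inner_trace hermitianD)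

lemma real_diag_nth [simp]: "real_diag d $ i $ j = (if i = j then complex_of_real (d $ i) else 0)"
  by (simp add: real_diag_def)

lemma hermitian_real_diag [simp]: "hermitian (real_diag d)"
  by (simp add: hermitian_def vec_eq_iff)

lemma adj_real_diag [simp]: "adj (real_diag d) = real_diag d"
  by (simp add: vec_eq_iff)

lemma real_diag_mult_nth: "(real_diag d ** A) $ i $ j = complex_of_real (d $ i) * A $ i $ j"
  by (simp add: matrix_matrix_mult_def if_distrib[of "\<lambda>x. x * _"] sum.delta cong: if_cong)

lemma mult_real_diag_nth: "(A ** real_diag d) $ i $ j = A $ i $ j * complex_of_real (d $ j)"
  by (simp add: matrix_matrix_mult_def if_distrib[of "\<lambda>x. _ * x"] sum.delta' cong: if_cong)

lemma real_diag_mult: "real_diag a ** real_diag b = real_diag (\<chi> i. a $ i * b $ i)"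
  by (simp add: vec_eq_iff real_diag_mult_nth)

lemma real_diag_1: "real_diag (\<chi> i. 1) = mat 1"
  by (simp add: vec_eq_iff mat_def)

lemma real_diag_add: "real_diag a + real_diag b = real_diag (a + b)"
  and real_diag_scaleR: "r *\<^sub>R real_diag a = real_diag (r *\<^sub>R a)"
  by (simp_all add: vec_eq_iff) (simp add: scaleR_conv_of_real)

lemma real_diag_vec: "(real_diag d *v x) $ i = d $ i *\<^sub>R x $ i"
  by (simp add: matrix_vector_mult_def if_distrib[of "\<lambda>x. x * _"] sum.delta scaleR_conv_of_real cong: if_cong)

lemma norm_axis_eq: "norm (axis i x :: 'a::real_normed_vector^'n) = norm x"
proof -
  have "norm (axis i x :: 'a^'n) = L2_set (\<lambda>j. if j = i then norm x else 0) UNIV"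
    unfolding norm_vec_def axis_def by (intro L2_set_cong) auto
  then show ?thesis by (simp add: L2_set_def if_distrib[of "\<lambda>x. x\<^sup>2"] sum.delta cong: if_cong)
qed

lemma norm_real_diag: "norm (real_diag d) = norm d"
proof -
  have "norm (real_diag d $ i) = \<bar>d $ i\<bar>" for i
  proof -
    have "real_diag d $ i = axis i (complex_of_real (d $ i))"
      by (simp add: vec_eq_iff axis_def)
    then show ?thesis by (simp add: norm_axis_eq)
  qed
  then show ?thesis by (simp add: norm_vec_def)
qed

lemma unitary_adj: "unitary U \<Longrightarrow> unitary (adj U)"
  by (simp add: unitary_def)

lemma unitaryD: "unitary U \<Longrightarrow> adj U ** U = mat 1" "unitary U \<Longrightarrow> U ** adj U = mat 1"
  by (simp_all add: unitary_def)

lemma unitary_cancel [simp]: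
  assumes "unitary U"
  shows "A ** adj U ** U = A" "A ** U ** adj U = A"
  by (simp_all only: matrix_mul_assoc[symmetric] unitaryD[OF assms] matrix_mul_rid)

lemma unitary_mult: "unitary U \<Longrightarrow> unitary V \<Longrightarrow> unitary (U ** V)"
  by (simp add: unitary_def[of "U ** V"] adj_mult matrix_mul_assoc unitaryD)

lemma unitaryI: "adj U ** U = mat 1 \<Longrightarrow> unitary U"
  using matrix_left_right_inverse by (auto simp: unitary_def)

lemma norm_unitary_left: "unitary U \<Longrightarrow> norm (U ** A) = norm A"
  by (simp add: norm_eq_sqrt_inner inner_mult_left matrix_mul_assoc unitaryD)

lemma norm_unitary_right: "unitary U \<Longrightarrow> norm (A ** U) = norm A"
  by (simp add: norm_eq_sqrt_inner inner_mult_right matrix_mul_assoc unitaryD)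

text \<open>A zero of a nonnegative quadratic form is a minimum, so the linear term in
  \<open>t\<close> of the form at \<open>u + t w\<close> must vanish. The subspace version produces
  eigenvectors; with the whole space it turns a vanishing form into a kernel vector.\<close>

lemma symmetric_psd_kernel:
  assumes S: "subspace S" and h: "hermitian A"
    and nn: "\<And>x. x \<in> S \<Longrightarrow> 0 \<le> x \<bullet> (A *v x)"
    and u: "u \<in> S" "u \<bullet> (A *v u) = 0" and w: "w \<in> S"
  shows "w \<bullet> (A *v u) = 0"
proof (rule ccontr)
  define b where "b = w \<bullet> (A *v u)"
  define c where "c = w \<bullet> (A *v w)"
  assume "w \<bullet> (A *v u) \<noteq> 0"
  then have b0: "b \<noteq> 0" by (simp add: b_def)
  have sym: "u \<bullet> (A *v w) = b"
    using hermitian_inner[OF h, of u w] by (simp add: b_def inner_commute)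
  have *: "0 \<le> 2 * t * b + t\<^sup>2 * c" for t
  proof -
    have "u + t *\<^sub>R w \<in> S" using S u w by (simp add: subspace_add subspace_scale)
    from nn[OF this] show ?thesis
      using u(2) sym
      by (simp add: b_def[symmetric] c_def[symmetric] matrix_vector_right_distrib
          mult_vec_scaleR inner_add algebra_simps power2_eq_square)
  qed
  have c0: "c \<ge> 0" using nn[OF w] by (simp add: c_def)
  \<comment> \<open>The denominator is \<open>c + 1\<close> rather than \<open>c\<close>, the
    optimal choice, because \<open>c\<close> may be zero.\<close>
  have "2 * (- b / (c + 1)) * b + (- b / (c + 1))\<^sup>2 * c = - (b\<^sup>2 * (c + 2)) / (c+1)\<^sup>2"
    using c0 by (simp add: divide_simps power2_eq_square) (simp add: algebra_simps)
  moreover have "b\<^sup>2 * (c + 2) / (c+1)\<^sup>2 > 0" using b0 c0 by simp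
  ultimately show False using *[of "- b / (c + 1)"] by simp
qed

text \<open>A maximiser of the Rayleigh quotient on the unit sphere of \<open>S\<close> is an
  eigenvector: \<open>l 1 - A\<close> is nonnegative on \<open>S\<close> and vanishes at
  \<open>u\<close>. Invariance of \<open>S\<close> allows \<open>B *v u\<close> to be tested against
  itself.\<close>

lemma hermitian_eigenvector_in_subspace:
  assumes S: "subspace S" "S \<noteq> {0}" and h: "hermitian A"
    and inv: "\<And>x. x \<in> S \<Longrightarrow> A *v x \<in> S"
  obtains u l where "u \<in> S" "norm u = 1" "A *v u = l *\<^sub>R u"
proof -
  let ?K = "S \<inter> sphere 0 1"
  have "compact ?K"
    using closed_Int_compact closed_subspace[OF S(1)] compact_sphere by blast
  moreover obtain x where x: "x \<in> S" "x \<noteq> 0" using S subspace_0 by blast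
  then have "(1 / norm x) *\<^sub>R x \<in> ?K" using S(1) by (simp add: subspace_scale)
  then have "?K \<noteq> {}" by blast
  moreover have "continuous_on ?K (\<lambda>x. x \<bullet> (A *v x))"
    by (intro continuous_intros linear_continuous_on matrix_vector_mul_bounded_linear)
  ultimately obtain u where u: "u \<in> ?K" and max: "\<And>x. x \<in> ?K \<Longrightarrow> x \<bullet> (A *v x) \<le> u \<bullet> (A *v u)"
    using continuous_attains_sup[of ?K "\<lambda>x. x \<bullet> (A *v x)"] by blast
  define l where "l = u \<bullet> (A *v u)"
  define B where "B = l *\<^sub>R mat 1 - A"
  have hB: "hermitian B" unfolding B_def by (intro hermitian_diff hermitian_scaleR h hermitian_mat1)
  have Bv: "B *v x = l *\<^sub>R x - A *v x" for x
    by (simp add: B_def matrix_vector_mult_diff_rdistrib scaleR_mult_vec)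
  have nn: "0 \<le> x \<bullet> (B *v x)" if "x \<in> S" for x
  proof (cases "x = 0")
    case False
    let ?y = "(1 / norm x) *\<^sub>R x"
    have "?y \<in> ?K" using that S(1) False by (simp add: subspace_scale)
    from max[OF this] have "(x \<bullet> (A *v x)) / (norm x)\<^sup>2 \<le> l"
      by (simp add: l_def mult_vec_scaleR power2_eq_square divide_simps)
    then have "x \<bullet> (A *v x) \<le> l * (x \<bullet> x)"
      using False by (simp add: divide_simps power2_norm_eq_inner)
    then show ?thesis by (simp add: Bv inner_diff_right)
  qed simp
  have uS: "u \<in> S" "norm u = 1" using u by auto
  have z: "u \<bullet> (B *v u) = 0"
    using uS(2) by (simp add: Bv inner_diff_right l_def[symmetric] power2_norm_eq_inner[symmetric])
  have "B *v u \<in> S" using uS S(1) inv by (simp add: Bv subspace_diff subspace_scale)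
  from symmetric_psd_kernel[OF S(1) hB nn uS(1) z this] have "B *v u = 0" by simp
  then have "A *v u = l *\<^sub>R u" by (simp add: Bv)
  with uS that show ?thesis by blast
qed

text \<open>The complex-valued Hermitian product. The real inner product of the type is its real
  part, and real orthogonality is weaker than the complex orthogonality that the columns of a
  unitary matrix require.\<close>

definition cdot :: "complex^'n \<Rightarrow> complex^'n \<Rightarrow> complex" where
  "cdot x y = (\<Sum>i\<in>UNIV. cnj (x $ i) * y $ i)"

lemma cdot_add: "cdot x (y + z) = cdot x y + cdot x z"
  and cdot_diff: "cdot x (y - z) = cdot x y - cdot x z"
  and cdot_scale: "cdot x (c *s y) = c * cdot x y"
  and cdot_scaleR: "cdot x (r *\<^sub>R y) = r *\<^sub>R cdot x y"
  by (simp_all add: cdot_def algebra_simps sum.distrib sum_subtractf sum_distrib_left scaleR_sum_right)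

lemma cdot_sum: "cdot x (\<Sum>e\<in>E. f e) = (\<Sum>e\<in>E. cdot x (f e))"
  unfolding cdot_def by (subst sum.swap) (simp add: sum_distrib_left)

lemma cdot_self: "cdot x x = of_real ((norm x)\<^sup>2)"
  by (simp add: cdot_def norm_vec_def L2_set_def sum_nonneg complex_norm_square mult.commute del: of_real_power)

lemma cdot_adj: "cdot x (A *v y) = cdot (adj A *v x) y"
proof -
  have "cdot x (A *v y) = (\<Sum>i\<in>UNIV. \<Sum>j\<in>UNIV. cnj (x$i) * (A$i$j * y$j))"
    by (simp only: cdot_def matrix_vector_mult_def vec_lambda_beta sum_distrib_left)
  also have "\<dots> = (\<Sum>j\<in>UNIV. \<Sum>i\<in>UNIV. cnj (x$i) * (A$i$j * y$j))"
    by (rule sum.swap)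
  also have "\<dots> = cdot (adj A *v x) y"
    by (simp only: cdot_def matrix_vector_mult_def vec_lambda_beta
        sum_distrib_left sum_distrib_right adj_nth cnj_sum complex_cnj_mult complex_cnj_cnj mult_ac)
  finally show ?thesis .
qed

lemma cdot_commute: "cdot x y = cnj (cdot y x)"
  by (simp add: cdot_def mult.commute)

text \<open>An orthonormal set of eigenvectors of maximal cardinality must span: its orthogonal
  complement is invariant under \<open>A\<close>, and a nonzero complement would contain a further
  eigenvector.\<close>

lemma hermitian_spectral:
  fixes A :: "complex^'n^'n"
  assumes h: "hermitian A"
  obtains U d where "unitary U" "A = U ** real_diag d ** adj U"
proof -
  define P where "P E \<longleftrightarrow> finite E \<and> (\<forall>e\<in>E. norm e = 1 \<and> (\<exists>l. A *v e = l *\<^sub>R e)) \<and>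
      (\<forall>e\<in>E. \<forall>f\<in>E. e \<noteq> f \<longrightarrow> cdot e f = 0)" for E :: "(complex^'n) set"
  have coef: "cdot e (\<Sum>f\<in>E. u f *s f) = u e" if "P E" "e \<in> E" for E u e
  proof -
    have "cdot e (\<Sum>f\<in>E. u f *s f) = (\<Sum>f\<in>E. if f = e then u e else 0)"
      unfolding cdot_sum cdot_scale
      using that by (intro sum.cong) (auto simp: P_def cdot_self)
    also have "\<dots> = u e" using that by (simp add: P_def)
    finally show ?thesis .
  qed
  have indep: "vec.independent E" if "P E" for E
  proof
    assume "vec.dependent E"
    moreover have "finite E" using that by (simp add: P_def)
    ultimately have "\<exists>u. (\<exists>v\<in>E. u v \<noteq> 0) \<and> (\<Sum>v\<in>E. u v *s v) = 0"
      by (simp only: vec.dependent_finite)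
    then obtain u e where u: "(\<Sum>v\<in>E. u v *s v) = 0" and e: "e \<in> E" "u e \<noteq> 0" by blast
    have "u e = cdot e 0" using coef[OF that e(1), of u] u by simp
    then show False using e by (simp add: cdot_def)
  qed
  have card: "card E \<le> CARD('n)" if "P E" for E
    using vec.independent_card_le_dim[OF subset_UNIV indep[OF that]] unfolding vec_dim_card .
  have "P {}" by (simp add: P_def)
  then obtain E where E: "P E" and Emax: "\<And>F. P F \<Longrightarrow> card F \<le> card E"
    using ex_has_greatest_nat[of P "{}" card "CARD('n) + 1"] card by (metis less_Suc_eq_le Suc_eq_plus1)
  have finE: "finite E" using E by (simp add: P_def)
  define S where "S = {x. \<forall>e\<in>E. cdot e x = 0}"
  have subS: "subspace S"
    by (auto simp: subspace_def S_def cdot_add cdot_scaleR) (simp add: cdot_def)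
  have invS: "A *v x \<in> S" if "x \<in> S" for x
  proof -
    have "cdot e (A *v x) = 0" if e: "e \<in> E" for e
    proof -
      obtain l where l: "A *v e = l *\<^sub>R e" using e E unfolding P_def by blast
      have "cdot e (A *v x) = cdot (l *\<^sub>R e) x"
        using h by (simp add: cdot_adj hermitian_def l)
      also have "\<dots> = l *\<^sub>R cdot e x" by (simp add: cdot_def scaleR_sum_right)
      finally show ?thesis using \<open>x \<in> S\<close> e by (simp add: S_def)
    qed
    then show ?thesis by (simp add: S_def)
  qed
  have S0: "S = {0}"
  proof (rule ccontr)
    assume "S \<noteq> {0}"
    then obtain u l where u: "u \<in> S" "norm u = 1" "A *v u = l *\<^sub>R u"
      using hermitian_eigenvector_in_subspace[OF subS _ h invS] by blast
    have nE: "u \<notin> E" using u by (auto simp: S_def cdot_self)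
    have "P (insert u E)"
      using E u by (auto simp: P_def S_def) (metis cdot_commute complex_cnj_zero_iff)
    from Emax[OF this] show False using finE nE by simp
  qed
  have "x \<in> vec.span E" for x
  proof -
    define y where "y = (\<Sum>f\<in>E. cdot f x *s f)"
    have "x - y \<in> S" using coef[OF E] by (simp add: S_def cdot_diff y_def)
    then have "x = y" using S0 by simp
    moreover have "y \<in> vec.span E" unfolding y_def
      by (intro vec.span_sum vec.span_scale vec.span_base)
    ultimately show ?thesis by simp
  qed
  then have "vec.span E = UNIV" by blast
  then have "card E = CARD('n)"
    using vec.dim_eq_card[of E UNIV] indep[OF E] unfolding vec_dim_card vec.span_UNIV by simp
  then obtain b :: "'n \<Rightarrow> complex^'n" where b: "bij_betw b UNIV E"
    using finE by (metis finite_same_card_bij finite)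
  have bE: "b i \<in> E" for i using b by (auto simp: bij_betw_def)
  have ex: "\<exists>l. A *v (b i) = l *\<^sub>R b i" for i
    using E bE unfolding P_def by blast
  then obtain l where l: "\<And>i. A *v (b i) = l i *\<^sub>R b i" by metis
  define U :: "complex^'n^'n" where "U = (\<chi> i j. b j $ i)"
  define d where "d = (\<chi> i. l i)"
  have "adj U ** U = mat 1"
  proof -
    have "(adj U ** U) $ i $ j = mat 1 $ i $ j" for i j
    proof -
      have "(adj U ** U) $ i $ j = cdot (b i) (b j)"
        by (simp add: matrix_matrix_mult_def U_def cdot_def)
      also have "\<dots> = (if i = j then 1 else 0)"
      proof (cases "i = j")
        case True
        then show ?thesis using E bE unfolding P_def by (simp add: cdot_self)
      next
        case False
        then have "b i \<noteq> b j" using b by (auto simp: bij_betw_def inj_def)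
        then show ?thesis using E bE False unfolding P_def by simp
      qed
      finally show ?thesis by (simp add: mat_def)
    qed
    then show ?thesis by (simp add: vec_eq_iff)
  qed
  then have U: "unitary U" by (rule unitaryI)
  have "A ** U = U ** real_diag d"
  proof -
    have "(A ** U) $ i $ j = (U ** real_diag d) $ i $ j" for i j
    proof -
      have "(A ** U) $ i $ j = (A *v b j) $ i"
        by (simp add: matrix_matrix_mult_def matrix_vector_mult_def U_def)
      then show ?thesis by (simp add: l mult_real_diag_nth U_def d_def) (simp add: scaleR_conv_of_real)
    qed
    then show ?thesis by (simp add: vec_eq_iff)
  qed
  then have "A = U ** real_diag d ** adj U"
    by (metis U unitary_cancel(2))
  with U that show ?thesis by blast
qed

subsection \<open>Functional calculus and congruence invariance of the trace metric\<close>

abbreviation vmap :: "(real \<Rightarrow> real) \<Rightarrow> real^'n \<Rightarrow> real^'n" where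
  "vmap f d \<equiv> (\<chi> i. f (d $ i))"

text \<open>The matrix \<open>W\<close> intertwines the two diagonals, so its entry at
  \<open>i\<close>, \<open>j\<close> vanishes unless \<open>a $ j = b $ i\<close>; where the
  eigenvalues agree, so do their images under \<open>f\<close>. This makes the description in
  \<open>hermitian_fun\<close> definite.\<close>

lemma diag_fun_unique:
  assumes U: "unitary U" and V: "unitary V"
    and eq: "U ** real_diag a ** adj U = V ** real_diag b ** adj V"
  shows "U ** real_diag (vmap f a) ** adj U = V ** real_diag (vmap f b) ** adj V"
proof -
  define W where "W = adj V ** U"
  have "W ** real_diag a = adj V ** (U ** real_diag a ** adj U) ** U"
    using U by (simp add: W_def matrix_mul_assoc)
  also have "\<dots> = real_diag b ** W"
    using V by (simp add: eq W_def matrix_mul_assoc unitaryD)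
  finally have e: "(W ** real_diag a) $ i $ j = (real_diag b ** W) $ i $ j" for i j by simp
  have z: "W $ i $ j = 0 \<or> a $ j = b $ i" for i j
    using e[of i j] by (auto simp: real_diag_mult_nth mult_real_diag_nth)
  have "(W ** real_diag (vmap f a)) $ i $ j = (real_diag (vmap f b) ** W) $ i $ j" for i j
    using z[of i j] by (auto simp: real_diag_mult_nth mult_real_diag_nth)
  then have "W ** real_diag (vmap f a) = real_diag (vmap f b) ** W" by (simp add: vec_eq_iff)
  then have "V ** (W ** real_diag (vmap f a)) ** adj U = V ** (real_diag (vmap f b) ** W) ** adj U"
    by simp
  then show ?thesis
    using U V by (simp add: W_def matrix_mul_assoc unitaryD)
qed

lemma hermitian_fun_diag:
  assumes U: "unitary U"
  shows "hermitian_fun f (U ** real_diag d ** adj U) = U ** real_diag (vmap f d) ** adj U"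
  unfolding hermitian_fun_def
proof (rule the_equality)
  show "\<exists>V e. unitary V \<and> U ** real_diag d ** adj U = V ** real_diag e ** adj V \<and>
     U ** real_diag (vmap f d) ** adj U = V ** real_diag (vmap f e) ** adj V"
    using U by blast
next
  fix B
  assume "\<exists>V e. unitary V \<and> U ** real_diag d ** adj U = V ** real_diag e ** adj V \<and>
     B = V ** real_diag (vmap f e) ** adj V"
  then obtain V e where V: "unitary V" "U ** real_diag d ** adj U = V ** real_diag e ** adj V"
    and B: "B = V ** real_diag (vmap f e) ** adj V" by blast
  show "B = U ** real_diag (vmap f d) ** adj U"
    unfolding B using diag_fun_unique[OF V(1) U V(2)[symmetric]] .
qed

lemma hermitian_fun_real_diag: "hermitian_fun f (real_diag d) = real_diag (vmap f d)"
  using hermitian_fun_diag[of "mat 1" f d] by (simp add: unitary_def)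

lemma hermitian_fun_unitary_conj:
  assumes A: "hermitian A" and U: "unitary U"
  shows "hermitian_fun f (adj U ** A ** U) = adj U ** hermitian_fun f A ** U"
proof -
  obtain V d where V: "unitary V" and Ad: "A = V ** real_diag d ** adj V"
    using hermitian_spectral[OF A] .
  define W where "W = adj U ** V"
  have W: "unitary W" unfolding W_def by (intro unitary_mult unitary_adj U V)
  have "adj U ** A ** U = W ** real_diag d ** adj W"
    by (simp add: W_def Ad adj_mult matrix_mul_assoc)
  then have "hermitian_fun f (adj U ** A ** U) = W ** real_diag (vmap f d) ** adj W"
    by (simp add: hermitian_fun_diag[OF W])
  also have "\<dots> = adj U ** hermitian_fun f A ** U"
    by (simp add: W_def Ad hermitian_fun_diag[OF V] adj_mult matrix_mul_assoc)
  finally show ?thesis .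
qed

lemma hermitian_diag [simp]: "hermitian (U ** real_diag d ** adj U)"
  by (simp add: hermitian_def adj_mult matrix_mul_assoc)

lemma hermitian_hermitian_fun [simp]:
  assumes "hermitian A"
  shows "hermitian (hermitian_fun f A)"
proof -
  obtain U d where "unitary U" "A = U ** real_diag d ** adj U"
    using hermitian_spectral[OF assms] .
  then show ?thesis by (simp add: hermitian_fun_diag)
qed

lemma hermitian_fun_mult:
  assumes "hermitian A"
  shows "hermitian_fun f A ** hermitian_fun g A = hermitian_fun (\<lambda>x. f x * g x) A"
proof -
  obtain U d where U: "unitary U" and A: "A = U ** real_diag d ** adj U"
    using hermitian_spectral[OF assms] .
  have "hermitian_fun f A ** hermitian_fun g A
      = U ** (real_diag (vmap f d) ** real_diag (vmap g d)) ** adj U"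
    unfolding A hermitian_fun_diag[OF U] using U by (simp add: matrix_mul_assoc)
  then show ?thesis unfolding A hermitian_fun_diag[OF U] by (simp add: real_diag_mult)
qed

lemma hermitian_fun_id:
  assumes "hermitian A"
  shows "hermitian_fun (\<lambda>x. x) A = A"
proof -
  obtain U d where U: "unitary U" and A: "A = U ** real_diag d ** adj U"
    using hermitian_spectral[OF assms] .
  show ?thesis unfolding A hermitian_fun_diag[OF U] by (simp add: vec_lambda_eta)
qed

lemma hermitian_fun_1:
  assumes "hermitian A"
  shows "hermitian_fun (\<lambda>x. 1) A = mat 1"
proof -
  obtain U d where U: "unitary U" and A: "A = U ** real_diag d ** adj U"
    using hermitian_spectral[OF assms] .
  show ?thesis unfolding A hermitian_fun_diag[OF U] by (simp add: real_diag_1 unitaryD[OF U])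
qed

lemma quadratic_diag:
  "x \<bullet> ((U ** real_diag d ** adj U) *v x) = (\<Sum>i\<in>UNIV. d $ i * (norm ((adj U *v x) $ i))\<^sup>2)"
proof -
  have "x \<bullet> ((U ** real_diag d ** adj U) *v x) = (adj U *v x) \<bullet> (real_diag d *v (adj U *v x))"
    by (simp add: matrix_vector_mul_assoc[symmetric] inner_adj del: matrix_vector_mul_assoc)
  then show ?thesis
    by (simp add: inner_vec_def real_diag_vec power2_norm_eq_inner)
qed

lemma norm_unitary_vec: "unitary U \<Longrightarrow> norm (U *v x) = norm x"
  by (simp add: norm_eq_sqrt_inner inner_adj[of _ U] matrix_vector_mul_assoc unitaryD)

lemma norm_vec_sq: "(\<Sum>i\<in>UNIV. (norm (x $ i))\<^sup>2) = (norm (x::complex^'n))\<^sup>2"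
  by (simp add: norm_vec_def L2_set_def sum_nonneg)

lemma quadratic_eigenvector:
  assumes U: "unitary U"
  obtains u where "norm u = 1" "u \<bullet> ((U ** real_diag d ** adj U) *v u) = d $ i"
proof
  let ?u = "U *v axis i 1"
  show "norm ?u = 1" by (simp add: norm_unitary_vec[OF U] norm_axis_eq)
  have "adj U *v ?u = axis i 1" by (simp add: matrix_vector_mul_assoc unitaryD[OF U])
  then show "?u \<bullet> ((U ** real_diag d ** adj U) *v ?u) = d $ i"
    unfolding quadratic_diag by (simp add: axis_def if_distrib[of norm] if_distrib[of "\<lambda>x. x\<^sup>2"]
        if_distrib[of "\<lambda>x. _ * x"] sum.delta cong: if_cong)
qed

lemma quadratic_ge_iff:
  assumes U: "unitary U"
  shows "(\<forall>x. c * (norm x)\<^sup>2 \<le> x \<bullet> ((U ** real_diag d ** adj U) *v x)) \<longleftrightarrow> (\<forall>i. c \<le> d $ i)"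
proof
  assume *: "\<forall>x. c * (norm x)\<^sup>2 \<le> x \<bullet> ((U ** real_diag d ** adj U) *v x)"
  show "\<forall>i. c \<le> d $ i"
  proof
    fix i
    obtain u where "norm u = 1" "u \<bullet> ((U ** real_diag d ** adj U) *v u) = d $ i"
      using quadratic_eigenvector[OF U] .
    then show "c \<le> d $ i" using *[rule_format, of u] by simp
  qed
next
  assume *: "\<forall>i. c \<le> d $ i"
  show "\<forall>x. c * (norm x)\<^sup>2 \<le> x \<bullet> ((U ** real_diag d ** adj U) *v x)"
  proof
    fix x
    have "c * (norm x)\<^sup>2 = (\<Sum>i\<in>UNIV. c * (norm ((adj U *v x) $ i))\<^sup>2)"
      by (simp add: sum_distrib_left[symmetric] norm_vec_sq norm_unitary_vec[OF unitary_adj[OF U]])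
    also have "\<dots> \<le> x \<bullet> ((U ** real_diag d ** adj U) *v x)"
      unfolding quadratic_diag using * by (intro sum_mono mult_right_mono) auto
    finally show "c * (norm x)\<^sup>2 \<le> x \<bullet> ((U ** real_diag d ** adj U) *v x)" .
  qed
qed

section \<open>Positive definite matrices and their square roots\<close>

lemma pd_hermitian: "A \<in> pd_matrices \<Longrightarrow> hermitian A"
  by (simp add: pd_matrices_def)

lemma pd_pos: "A \<in> pd_matrices \<Longrightarrow> x \<noteq> 0 \<Longrightarrow> 0 < x \<bullet> (A *v x)"
  by (simp add: pd_matrices_def)

lemma pd_lower_boundI:
  assumes "hermitian A" "c > 0" "\<And>x. c * (norm x)\<^sup>2 \<le> x \<bullet> (A *v x)"
  shows "A \<in> pd_matrices"
  unfolding pd_matrices_def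
proof (safe intro!: assms(1))
  fix x :: "complex^'a" assume "x \<noteq> 0"
  then have "0 < c * (norm x)\<^sup>2" using assms by simp
  then show "0 < x \<bullet> (A *v x)" using assms(3)[of x] by linarith
qed

lemma pd_diag_iff:
  assumes U: "unitary U"
  shows "U ** real_diag d ** adj U \<in> pd_matrices \<longleftrightarrow> (\<forall>i. 0 < d $ i)"
proof
  assume *: "U ** real_diag d ** adj U \<in> pd_matrices"
  show "\<forall>i. 0 < d $ i"
  proof
    fix i
    obtain u where "norm u = 1" "u \<bullet> ((U ** real_diag d ** adj U) *v u) = d $ i"
      using quadratic_eigenvector[OF U] .
    then show "0 < d $ i" using pd_pos[OF *, of u] by (cases "u = 0") auto
  qed
next
  assume *: "\<forall>i. 0 < d $ i"
  define c where "c = Min (range (($) d))"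
  have "c > 0" using * by (simp add: c_def)
  moreover have "\<forall>i. c \<le> d $ i" by (simp add: c_def)
  ultimately show "U ** real_diag d ** adj U \<in> pd_matrices"
    using quadratic_ge_iff[OF U, of c d] by (intro pd_lower_boundI[of _ c]) auto
qed

lemma pd_spectral:
  assumes A: "A \<in> pd_matrices"
  obtains U d where "unitary U" "A = U ** real_diag d ** adj U" "\<forall>i. 0 < d $ i"
proof -
  obtain U d where U: "unitary U" and Ad: "A = U ** real_diag d ** adj U"
    using hermitian_spectral[OF pd_hermitian[OF A]] .
  have "\<forall>i. 0 < d $ i" using A pd_diag_iff[OF U] by (simp add: Ad)
  with U Ad that show ?thesis by blast
qed

lemma pd_lower_bound:
  assumes A: "A \<in> pd_matrices"
  obtains c where "c > 0" "\<forall>x. c * (norm x)\<^sup>2 \<le> x \<bullet> (A *v x)"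
proof -
  obtain U d where U: "unitary U" and Ad: "A = U ** real_diag d ** adj U" and d: "\<forall>i. 0 < d $ i"
    using pd_spectral[OF A] .
  define c where "c = Min (range (($) d))"
  have "c > 0" using d by (simp add: c_def)
  moreover have "\<forall>i. c \<le> d $ i" by (simp add: c_def)
  ultimately show ?thesis
    using quadratic_ge_iff[OF U, of c d] that Ad by blast
qed

text \<open>Identities for \<open>powr\<close> and \<open>ln\<close> are available on the positive
  reals, which contain the spectrum of a positive definite matrix.\<close>

lemma hermitian_fun_cong_pd:
  assumes A: "A \<in> pd_matrices" and f: "\<And>x. x > 0 \<Longrightarrow> f x = g x"
  shows "hermitian_fun f A = hermitian_fun g A"
proof -
  obtain U d where U: "unitary U" and Ad: "A = U ** real_diag d ** adj U" and d: "\<forall>i. 0 < d $ i"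
    using pd_spectral[OF A] .
  show ?thesis unfolding Ad hermitian_fun_diag[OF U] using f d by simp
qed

lemma pd_mat1 [simp]: "mat 1 \<in> pd_matrices"
  by (simp add: pd_matrices_def)

lemma pd_congr:
  assumes A: "A \<in> pd_matrices" and K: "invertible K"
  shows "adj K ** A ** K \<in> pd_matrices"
proof -
  have "0 < x \<bullet> ((adj K ** A ** K) *v x)" if "x \<noteq> 0" for x
  proof -
    have "K *v x \<noteq> 0"
      using K that by (metis invertible_def matrix_left_invertible_ker)
    moreover have "x \<bullet> ((adj K ** A ** K) *v x) = (K *v x) \<bullet> (A *v (K *v x))"
      by (simp add: matrix_vector_mul_assoc[symmetric] inner_adj del: matrix_vector_mul_assoc)
    ultimately show ?thesis using pd_pos[OF A] by simp
  qed
  then show ?thesis using pd_hermitian[OF A] by (simp add: pd_matrices_def hermitian_congr)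
qed

definition isqrt_mat :: "complex^'n^'n \<Rightarrow> complex^'n^'n" where
  "isqrt_mat A = matrix_powr A (-1/2)"

definition sqrt_mat :: "complex^'n^'n \<Rightarrow> complex^'n^'n" where
  "sqrt_mat A = matrix_powr A (1/2)"

lemma sqrt_mat:
  assumes A: "A \<in> pd_matrices"
  shows "hermitian (isqrt_mat A)" "hermitian (sqrt_mat A)"
    "isqrt_mat A ** sqrt_mat A = mat 1" "sqrt_mat A ** isqrt_mat A = mat 1"
    "sqrt_mat A ** sqrt_mat A = A" "isqrt_mat A ** A ** isqrt_mat A = mat 1"
    "invertible (isqrt_mat A)" "invertible (sqrt_mat A)"
proof -
  note h = pd_hermitian[OF A]
  show "hermitian (isqrt_mat A)" "hermitian (sqrt_mat A)"
    using h by (simp_all add: isqrt_mat_def sqrt_mat_def matrix_powr_def)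
  have e1: "hermitian_fun (\<lambda>x. x powr (-1/2) * x powr (1/2)) A = mat 1"
    using hermitian_fun_cong_pd[OF A, of "\<lambda>x. x powr (-1/2) * x powr (1/2)" "\<lambda>x. 1"] hermitian_fun_1[OF h]
    by (simp add: powr_add[symmetric])
  have e2: "hermitian_fun (\<lambda>x. x powr (1/2) * x powr (-1/2)) A = mat 1"
    using e1 by (simp add: mult.commute)
  have e3: "hermitian_fun (\<lambda>x. x powr (1/2) * x powr (1/2)) A = A"
    using hermitian_fun_cong_pd[OF A, of "\<lambda>x. x powr (1/2) * x powr (1/2)" "\<lambda>x. x"] hermitian_fun_id[OF h]
    by (simp add: powr_add[symmetric])
  show i: "isqrt_mat A ** sqrt_mat A = mat 1" "sqrt_mat A ** isqrt_mat A = mat 1"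
    and s: "sqrt_mat A ** sqrt_mat A = A"
    unfolding isqrt_mat_def sqrt_mat_def matrix_powr_def using e1 e2 e3
    by (simp_all add: hermitian_fun_mult[OF h])
  have "isqrt_mat A ** (sqrt_mat A ** sqrt_mat A) ** isqrt_mat A
    = (isqrt_mat A ** sqrt_mat A) ** (sqrt_mat A ** isqrt_mat A)"
    by (simp only: matrix_mul_assoc)
  then show "isqrt_mat A ** A ** isqrt_mat A = mat 1" by (simp add: i s)
  show "invertible (isqrt_mat A)" "invertible (sqrt_mat A)"
    using i by (auto simp: invertible_def)
qed

lemma hermitian_ln: "hermitian A \<Longrightarrow> hermitian (matrix_ln A)"
  by (simp add: matrix_ln_def)

section \<open>The trace metric under congruence\<close>

lemma trace_dist_alt:
  assumes "A \<in> pd_matrices" "B \<in> pd_matrices"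
  shows "trace_dist A B = norm (matrix_ln (isqrt_mat A ** B ** isqrt_mat A))"
proof -
  have "hermitian (isqrt_mat A ** B ** isqrt_mat A)"
    using hermitian_congr[OF pd_hermitian[OF assms(2)], of "isqrt_mat A"]
    by (simp add: hermitianD sqrt_mat[OF assms(1)])
  then show ?thesis
    unfolding trace_dist_def by (simp add: isqrt_mat_def hs_norm_eq_norm hermitian_ln)
qed

text \<open>Any \<open>K\<close> that normalises \<open>A\<close> to the identity equals
  \<open>isqrt_mat A\<close> times a unitary matrix, and the norm of the logarithm is blind to
  unitary conjugation. The distance is thereby freed from the particular square root in its
  definition.\<close>

lemma trace_dist_congr:
  fixes A B K :: "complex^'n^'n"
  assumes A: "A \<in> pd_matrices" and B: "B \<in> pd_matrices" and K: "adj K ** A ** K = mat 1"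
  shows "trace_dist A B = norm (matrix_ln (adj K ** B ** K))"
proof -
  let ?S = "isqrt_mat A" and ?R = "sqrt_mat A"
  note R = sqrt_mat[OF A]
  define U where "U = ?R ** K"
  have "adj U ** U = adj K ** (?R ** ?R) ** K"
    by (simp add: U_def adj_mult hermitianD R(1,2) matrix_mul_assoc)
  then have U: "unitary U" using K R(5) by (intro unitaryI) simp
  have K: "K = ?S ** U" by (simp add: U_def matrix_mul_assoc R)
  have "hermitian (?S ** B ** ?S)"
    using hermitian_congr[OF pd_hermitian[OF B], of ?S] by (simp add: hermitianD R(1))
  moreover have "adj K ** B ** K = adj U ** (?S ** B ** ?S) ** U"
    by (simp add: K adj_mult hermitianD R(1) matrix_mul_assoc)
  ultimately have "matrix_ln (adj K ** B ** K) = adj U ** matrix_ln (?S ** B ** ?S) ** U"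
    using U by (simp add: matrix_ln_def hermitian_fun_unitary_conj)
  then show ?thesis
    using U by (simp add: trace_dist_alt[OF A B] norm_unitary_right norm_unitary_left unitary_adj)
qed

lemma trace_dist_congruence:
  fixes A B L :: "complex^'n^'n"
  assumes A: "A \<in> pd_matrices" and B: "B \<in> pd_matrices" and L: "invertible L"
  shows "trace_dist (adj L ** A ** L) (adj L ** B ** L) = trace_dist A B"
proof -
  obtain L' where L': "L ** L' = mat 1" using L by (auto simp: invertible_def)
  then have L'2: "adj L' ** adj L = mat 1" using adj_mult[of L L'] by simp
  let ?S = "isqrt_mat A"
  note R = sqrt_mat[OF A]
  have *: "adj (L' ** ?S) ** (adj L ** C ** L) ** (L' ** ?S) = ?S ** C ** ?S" for C
  proof -
    have "adj (L' ** ?S) ** (adj L ** C ** L) ** (L' ** ?S)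
      = ?S ** (adj L' ** adj L) ** C ** (L ** L') ** ?S"
      by (simp add: adj_mult hermitianD R(1) matrix_mul_assoc)
    then show ?thesis by (simp add: L' L'2)
  qed
  show ?thesis
    using trace_dist_congr[OF pd_congr[OF A L] pd_congr[OF B L], of "L' ** ?S"]
    by (simp add: * R(6) trace_dist_alt[OF A B])
qed

text \<open>Diagonalising \<open>B\<close> relative to \<open>A\<close> brings the pair to the
  identity and \<open>diag (exp h)\<close> by one congruence. The geodesic from \<open>A\<close> to
  \<open>B\<close> is then \<open>adj Q ** diag (exp (t h)) ** Q\<close>, so two-point facts about
  the metric become facts about diagonal matrices.\<close>

lemma simultaneous_diag:
  fixes A B :: "complex^'n^'n"
  assumes A: "A \<in> pd_matrices" and B: "B \<in> pd_matrices"
  obtains Q :: "complex^'n^'n" and h where "invertible Q" "A = adj Q ** Q" "B = adj Q ** real_diag (vmap exp h) ** Q"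
proof -
  let ?S = "isqrt_mat A" and ?R = "sqrt_mat A"
  note R = sqrt_mat[OF A]
  have "adj ?S ** B ** ?S \<in> pd_matrices" by (intro pd_congr B R)
  then obtain U d where U: "unitary U" and d: "adj ?S ** B ** ?S = U ** real_diag d ** adj U" "\<forall>i. 0 < d $ i"
    using pd_spectral by blast
  define Q where "Q = adj U ** ?R"
  have iQ: "invertible Q" unfolding Q_def
    using U by (intro invertible_mult R) (auto simp: invertible_def unitary_def)
  have "adj Q ** Q = A"
    using U by (simp add: Q_def adj_mult hermitianD R matrix_mul_assoc)
  moreover have "vmap exp (vmap ln d) = d" using d(2) by (simp add: vec_eq_iff)
  moreover have "adj Q ** real_diag d ** Q = (?R ** ?S) ** B ** (?S ** ?R)"
  proof -
    have "adj Q ** real_diag d ** Q = ?R ** (U ** real_diag d ** adj U) ** ?R"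
      by (simp add: Q_def adj_mult hermitianD R(1,2) matrix_mul_assoc)
    then show ?thesis by (simp add: d(1)[symmetric] hermitianD R(1,2) matrix_mul_assoc)
  qed
  then have "adj Q ** real_diag d ** Q = B" by (simp add: R)
  ultimately show ?thesis using that[of Q "vmap ln d"] iQ by metis
qed

lemma pd_real_diag_exp [simp]: "real_diag (vmap exp h) \<in> pd_matrices"
  using pd_diag_iff[of "mat 1" "vmap exp h"] by (simp add: unitary_def)

lemma trace_dist_1: "A \<in> pd_matrices \<Longrightarrow> trace_dist (mat 1) A = norm (matrix_ln A)"
  using trace_dist_congr[OF pd_mat1, of A "mat 1"] by simp

text \<open>Positive diagonal matrices form a flat: the entrywise exponential is an isometric
  embedding of Euclidean space.\<close>

lemma trace_dist_diag:
  "trace_dist (real_diag (vmap exp g)) (real_diag (vmap exp h)) = norm (h - g)"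
proof -
  let ?K = "real_diag (vmap (\<lambda>x. exp (- x / 2)) g)"
  have "adj ?K ** real_diag (vmap exp f) ** ?K = real_diag (vmap exp (f - g))" for f
    by (simp add: real_diag_mult exp_add[symmetric] minus_vec_def)
  then show ?thesis
    using trace_dist_congr[of "real_diag (vmap exp g)" "real_diag (vmap exp h)" ?K]
    by (simp add: matrix_ln_def hermitian_fun_real_diag norm_real_diag real_diag_1 minus_vec_def)
qed

lemma trace_dist_sym:
  fixes A B :: "complex^'n^'n"
  assumes "A \<in> pd_matrices" "B \<in> pd_matrices"
  shows "trace_dist A B = trace_dist B A"
proof -
  obtain Q :: "complex^'n^'n" and h where Q: "invertible Q" and A: "A = adj Q ** Q" and B: "B = adj Q ** real_diag (vmap exp h) ** Q"
    using simultaneous_diag[OF assms] .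
  have A': "A = adj Q ** real_diag (vmap exp 0) ** Q" by (simp add: A real_diag_1)
  show ?thesis
    unfolding A' B using Q by (simp add: trace_dist_congruence trace_dist_diag del: zero_index)
qed

subsection \<open>Continuity and differentiability of the logarithm\<close>

lemma real_diag_inner: "real_diag a \<bullet> M = (\<Sum>i\<in>UNIV. a $ i * Re (M $ i $ i))"
proof -
  have "real_diag a \<bullet> M = (\<Sum>i\<in>UNIV. \<Sum>j\<in>UNIV. if j = i then a $ i * Re (M $ i $ i) else 0)"
    unfolding inner_vec_def by (intro sum.cong refl) (auto simp: complex_inner_Re)
  then show ?thesis by simp
qed

text \<open>The matrix \<open>(|(U\<^sup>*V)\<^bsub>ij\<^esub>|\<^sup>2)\<close> is doubly stochastic; this reduces trace inequalities for two
  non-commuting matrices to scalar inequalities between their eigenvalues.\<close>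

lemma inner_diag_diag:
  "(U ** real_diag a ** adj U) \<bullet> (V ** real_diag b ** adj V)
    = (\<Sum>i\<in>UNIV. \<Sum>j\<in>UNIV. (norm ((adj U ** V) $ i $ j))\<^sup>2 * (a $ i * b $ j))"
proof -
  let ?W = "adj U ** V"
  have "(U ** real_diag a ** adj U) \<bullet> (V ** real_diag b ** adj V)
      = real_diag a \<bullet> (?W ** real_diag b ** adj ?W)"
    by (simp add: inner_mult_right[of "U ** real_diag a"] inner_mult_left[of U] adj_mult matrix_mul_assoc)
  also have "\<dots> = (\<Sum>i\<in>UNIV. a $ i * (\<Sum>j\<in>UNIV. (norm (?W $ i $ j))\<^sup>2 * b $ j))"
    unfolding real_diag_inner
  proof (intro sum.cong refl, goal_cases)
    case (1 i)
    have "(?W ** real_diag b ** adj ?W) $ i $ i = (\<Sum>j\<in>UNIV. (?W ** real_diag b) $ i $ j * cnj (?W $ i $ j))"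
      by (simp add: matrix_matrix_mult_def[of "?W ** real_diag b" "adj ?W"])
    also have "\<dots> = (\<Sum>j\<in>UNIV. complex_of_real ((norm (?W $ i $ j))\<^sup>2 * b $ j))"
      by (intro sum.cong refl) (simp add: mult_real_diag_nth complex_norm_square[symmetric] mult_ac)
    also have "\<dots> = complex_of_real (\<Sum>j\<in>UNIV. (norm (?W $ i $ j))\<^sup>2 * b $ j)" by simp
    finally show ?case by simp
  qed
  finally show ?thesis by (simp add: sum_distrib_left mult_ac)
qed

text \<open>One family of weights \<open>w\<close> serves all pairs \<open>f\<close>,
  \<open>g\<close>. This lets different trace expressions in \<open>A\<close> and \<open>B\<close>
  be compared term by term.\<close>

lemma spectral_pair:
  fixes A B :: "complex^'n^'n"
  assumes U: "unitary U" and A: "A = U ** real_diag a ** adj U" and B: "hermitian B"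
  obtains V b w where "unitary V" "B = V ** real_diag b ** adj V"
    "\<forall>i j. 0 \<le> w i j"
    "\<forall>f g. hermitian_fun f A \<bullet> hermitian_fun g B
      = (\<Sum>i\<in>UNIV. \<Sum>j\<in>UNIV. w i j * (f (a $ i) * g (b $ j)))"
proof -
  obtain V b where V: "unitary V" and Bd: "B = V ** real_diag b ** adj V"
    using hermitian_spectral[OF B] .
  show ?thesis
    by (rule that[of V b "\<lambda>i j. (norm ((adj U ** V) $ i $ j))\<^sup>2"])
      (simp_all add: V Bd A hermitian_fun_diag[OF U] hermitian_fun_diag[OF V] inner_diag_diag)
qed

text \<open>The last factor is the identity, written as a function of \<open>B\<close> so that a
  quantity depending on \<open>A\<close> alone can also be expanded in the weights of the
  pair.\<close>

lemma inner_hermitian_fun: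
  assumes A: "hermitian A" and B: "hermitian B"
  shows "hermitian_fun f A \<bullet> hermitian_fun g A
    = hermitian_fun (\<lambda>x. f x * g x) A \<bullet> hermitian_fun (\<lambda>x. 1) B"
proof -
  have "hermitian_fun f A \<bullet> hermitian_fun g A
      = mat 1 \<bullet> (hermitian_fun f A ** hermitian_fun g A)"
    by (simp add: matrix_inner_trace hermitianD[OF hermitian_hermitian_fun[OF A]])
  then show ?thesis
    by (simp add: hermitian_fun_mult[OF A] hermitian_fun_1[OF B] inner_commute)
qed

text \<open>All three terms of the expanded square are sums with the same weights, so they recombine
  into scalar squares. With \<open>f\<close> the identity the left side is the squared distance of
  \<open>A\<close> and \<open>B\<close>, the benchmark for other \<open>f\<close>.\<close>

lemma norm_hermitian_fun_diff:
  assumes A: "hermitian A" and B: "hermitian B"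
    and w: "\<And>f g. hermitian_fun f A \<bullet> hermitian_fun g B
      = (\<Sum>i\<in>I. \<Sum>j\<in>J. w i j * (f (a i) * g (b j)))"
  shows "(norm (hermitian_fun f A - hermitian_fun f B))\<^sup>2
    = (\<Sum>i\<in>I. \<Sum>j\<in>J. w i j * (f (a i) - f (b j))\<^sup>2)"
proof -
  have "(norm (hermitian_fun f A - hermitian_fun f B))\<^sup>2
      = hermitian_fun f A \<bullet> hermitian_fun f A + hermitian_fun f B \<bullet> hermitian_fun f B
        - 2 * (hermitian_fun f A \<bullet> hermitian_fun f B)"
    by (simp add: power2_norm_eq_inner inner_diff inner_commute)
  also have "hermitian_fun f A \<bullet> hermitian_fun f A
      = (\<Sum>i\<in>I. \<Sum>j\<in>J. w i j * (f (a i) * f (a i) * 1))"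
    by (simp only: inner_hermitian_fun[OF A B] w)
  also have "hermitian_fun f B \<bullet> hermitian_fun f B
      = (\<Sum>i\<in>I. \<Sum>j\<in>J. w i j * (1 * (f (b j) * f (b j))))"
    using w[of "\<lambda>x. 1" "\<lambda>x. f x * f x"] by (simp only: inner_hermitian_fun[OF B A] inner_commute)
  also have "hermitian_fun f A \<bullet> hermitian_fun f B
      = (\<Sum>i\<in>I. \<Sum>j\<in>J. w i j * (f (a i) * f (b j)))" by (rule w)
  finally show ?thesis
    by (simp add: power2_diff algebra_simps power2_eq_square sum.distrib sum_subtractf sum_distrib_left)
qed

lemma hermitian_quadratic_ge_norm:
  assumes "hermitian D"
  shows "- norm D * (norm x)\<^sup>2 \<le> x \<bullet> (D *v x)"
proof -
  obtain U d where U: "unitary U" and D: "D = U ** real_diag d ** adj U"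
    using hermitian_spectral[OF assms] .
  have "norm D = norm d"
    using U by (simp add: D norm_unitary_left norm_unitary_right unitary_adj norm_real_diag)
  then have "- norm D \<le> d $ i" for i
    using component_le_norm_cart[of d i] by simp
  then show ?thesis using quadratic_ge_iff[OF U, of "- norm D" d] D by blast
qed

lemma pd_perturb_lower_bound:
  assumes A: "hermitian A" "\<And>x. 2 * c * (norm x)\<^sup>2 \<le> x \<bullet> (A *v x)"
    and B: "hermitian B" and d: "norm (B - A) \<le> c"
  shows "c * (norm x)\<^sup>2 \<le> x \<bullet> (B *v x)"
proof -
  have "- norm (B - A) * (norm x)\<^sup>2 \<le> x \<bullet> ((B - A) *v x)"
    by (intro hermitian_quadratic_ge_norm hermitian_diff A B)
  moreover have "norm (B - A) * (norm x)\<^sup>2 \<le> c * (norm x)\<^sup>2" using d by (simp add: mult_right_mono)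
  ultimately show ?thesis using A(2)[of x]
    by (simp add: matrix_vector_mult_diff_rdistrib inner_diff_right)
qed

lemma abs_ln_diff_le:
  fixes x y c :: real
  assumes "0 < c" "c \<le> x" "c \<le> y"
  shows "\<bar>ln x - ln y\<bar> \<le> \<bar>x - y\<bar> / c"
proof -
  have *: "ln x - ln y \<le> \<bar>x - y\<bar> / c" if "c \<le> x" "c \<le> y" for x y
  proof -
    have "ln (x / y) \<le> x / y - 1" using that assms(1) by (intro ln_le_minus_one) simp
    then have "ln x - ln y \<le> (x - y) / y" using that assms(1) by (simp add: ln_div diff_divide_distrib)
    also have "\<dots> \<le> \<bar>x - y\<bar> / c" using that assms(1) by (intro frac_le) auto
    finally show ?thesis .
  qed
  show ?thesis using *[OF assms(2,3)] *[OF assms(3,2)] by (simp add: abs_minus_commute abs_le_iff)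
qed

text \<open>On the reals above \<open>c\<close> the scalar logarithm has Lipschitz constant
  \<open>1 / c\<close>. The constant survives for matrices because both squared norms weight squared
  scalar differences identically.\<close>

lemma norm_matrix_ln_diff_le:
  fixes A B :: "complex^'n^'n"
  assumes A: "hermitian A" "\<And>x. c * (norm x)\<^sup>2 \<le> x \<bullet> (A *v x)"
    and B: "hermitian B" "\<And>x. c * (norm x)\<^sup>2 \<le> x \<bullet> (B *v x)" and c: "0 < c"
  shows "norm (matrix_ln A - matrix_ln B) \<le> norm (A - B) / c"
proof -
  obtain U a where U: "unitary U" and Ad: "A = U ** real_diag a ** adj U"
    using hermitian_spectral[OF A(1)] .
  obtain V b w where V: "unitary V" and Bd: "B = V ** real_diag b ** adj V"
    and w0': "\<forall>i j. 0 \<le> w i j"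
    and w': "\<forall>f g. hermitian_fun f A \<bullet> hermitian_fun g B
      = (\<Sum>i\<in>UNIV. \<Sum>j\<in>UNIV. w i j * (f (a $ i) * g (b $ j)))"
    using spectral_pair[OF U Ad B(1)] .
  note w = w'[rule_format] and w0 = w0'[rule_format]
  have a: "c \<le> a $ i" for i using A(2) quadratic_ge_iff[OF U, of c a] by (simp add: Ad)
  have b: "c \<le> b $ i" for i using B(2) quadratic_ge_iff[OF V, of c b] by (simp add: Bd)
  note nd = norm_hermitian_fun_diff[OF A(1) B(1) w]
  have "(norm (matrix_ln A - matrix_ln B))\<^sup>2
      = (\<Sum>i\<in>UNIV. \<Sum>j\<in>UNIV. w i j * (ln (a $ i) - ln (b $ j))\<^sup>2)"
    unfolding matrix_ln_def nd ..
  also have "\<dots> \<le> (\<Sum>i\<in>UNIV. \<Sum>j\<in>UNIV. w i j * ((a $ i - b $ j) / c)\<^sup>2)"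
  proof (intro sum_mono mult_left_mono w0)
    fix i j
    have "\<bar>ln (a $ i) - ln (b $ j)\<bar> \<le> \<bar>(a $ i - b $ j) / c\<bar>"
      using abs_ln_diff_le[OF c a b] c by simp
    then show "(ln (a $ i) - ln (b $ j))\<^sup>2 \<le> ((a $ i - b $ j) / c)\<^sup>2" by (simp only: abs_le_square_iff)
  qed
  also have "\<dots> = (\<Sum>i\<in>UNIV. \<Sum>j\<in>UNIV. w i j * (a $ i - b $ j)\<^sup>2) / c\<^sup>2"
    by (simp add: power_divide sum_divide_distrib)
  also have "(\<Sum>i\<in>UNIV. \<Sum>j\<in>UNIV. w i j * (a $ i - b $ j)\<^sup>2) = (norm (A - B))\<^sup>2"
    using nd[of "\<lambda>x. x"] by (simp add: hermitian_fun_id[OF A(1)] hermitian_fun_id[OF B(1)])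
  also have "(norm (A - B))\<^sup>2 / c\<^sup>2 = (norm (A - B) / c)\<^sup>2" by (simp add: power_divide)
  finally show ?thesis by (rule power2_le_imp_le) (use c in simp)
qed

lemma continuous_on_matrix_ln: "continuous_on pd_matrices matrix_ln"
  unfolding continuous_on_iff
proof (intro ballI allI impI)
  fix A :: "complex^'n^'n" and e :: real
  assume A: "A \<in> pd_matrices" and e: "0 < e"
  obtain c0 where c0: "c0 > 0" "\<forall>x. c0 * (norm x)\<^sup>2 \<le> x \<bullet> (A *v x)"
    using pd_lower_bound[OF A] .
  \<comment> \<open>Half of the lower bound is kept in reserve, so that every Hermitian matrix
    within distance \<open>c\<close> of \<open>A\<close> still has its form bounded below by
    \<open>c\<close>.\<close>
  define c where "c = c0 / 2"
  have c: "c > 0" "2 * c * (norm x)\<^sup>2 \<le> x \<bullet> (A *v x)" for x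
    using c0(1) c0(2)[rule_format, of x] by (simp_all add: c_def)
  have hA: "hermitian A" by (rule pd_hermitian[OF A])
  have c1: "c * (norm x)\<^sup>2 \<le> x \<bullet> (A *v x)" for x
    using pd_perturb_lower_bound[OF hA c(2) hA, of x] c(1) by simp
  show "\<exists>d>0. \<forall>B\<in>pd_matrices. dist B A < d \<longrightarrow> dist (matrix_ln B) (matrix_ln A) < e"
  proof (intro exI[of _ "min c (e * c)"] conjI ballI impI)
    show "0 < min c (e * c)" using c e by simp
    fix B :: "complex^'n^'n"
    assume B: "B \<in> pd_matrices" and d: "dist B A < min c (e * c)"
    have hB: "hermitian B" by (rule pd_hermitian[OF B])
    have "norm (B - A) \<le> c" using d by (simp add: dist_norm)
    note b = pd_perturb_lower_bound[OF hA c(2) hB this]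
    have "norm (matrix_ln B - matrix_ln A) \<le> norm (B - A) / c"
      by (rule norm_matrix_ln_diff_le[OF hB b hA c1 c(1)])
    also have "\<dots> < e" using d c by (simp add: dist_norm divide_less_eq)
    finally show "dist (matrix_ln B) (matrix_ln A) < e" by (simp add: dist_norm)
  qed
qed

text \<open>First-order Taylor expansion of the squared logarithm at \<open>a\<close>. With
  \<open>u = b / a\<close>, everything comes from \<open>1 - 1/u \<le> ln u \<le> u - 1\<close>; the
  lower bound \<open>c\<close> enters through \<open>1/u \<le> a/c\<close>, and the estimate is
  uniform in all \<open>b \<ge> c\<close>.\<close>

lemma ln_squared_remainder:
  fixes a b c :: real
  assumes a: "0 < a" and c: "0 < c" "c \<le> b"
  shows "\<bar>(ln b)\<^sup>2 - (ln a)\<^sup>2 - 2 * (ln a / a) * (b - a)\<bar>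
    \<le> (b - a)\<^sup>2 * ((2 * \<bar>ln a\<bar> * (a / c) + 1 + (a / c)\<^sup>2) / a\<^sup>2)"
proof -
  define u where "u = b / a"
  have u0: "u > 0" and b0: "b > 0" using a c by (auto simp: u_def)
  have lnb: "ln b = ln a + ln u" using a b0 by (simp add: u_def ln_div)
  have ba: "b - a = a * (u - 1)" using a by (simp add: u_def algebra_simps)
  have uc: "1 / u \<le> a / c" using a c by (simp add: u_def frac_le)
  have l1: "ln u \<le> u - 1" by (rule ln_le_minus_one[OF u0])
  have "ln (1 / u) \<le> 1 / u - 1" using u0 by (intro ln_le_minus_one) simp
  then have l2: "1 - 1 / u \<le> ln u" using u0 by (simp add: ln_div)
  have r1: "\<bar>ln u - (u - 1)\<bar> \<le> (u - 1)\<^sup>2 * (a / c)"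
  proof -
    have "\<bar>ln u - (u - 1)\<bar> \<le> u - 1 - (1 - 1 / u)" using l1 l2 by linarith
    also have "\<dots> = (u - 1)\<^sup>2 * (1 / u)" using u0 by (simp add: field_simps power2_eq_square)
    also have "\<dots> \<le> (u - 1)\<^sup>2 * (a / c)" by (intro mult_left_mono uc) simp
    finally show ?thesis .
  qed
  have r2: "(ln u)\<^sup>2 \<le> (u - 1)\<^sup>2 * (1 + (a / c)\<^sup>2)"
  proof (cases "u \<ge> 1")
    case True
    then have "(ln u)\<^sup>2 \<le> (u - 1)\<^sup>2" using l1 by (intro power_mono) auto
    also have "\<dots> \<le> (u - 1)\<^sup>2 * (1 + (a / c)\<^sup>2)" by (simp add: algebra_simps)
    finally show ?thesis .
  next
    case False
    then have "ln u \<le> 0" using u0 by simp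
    moreover have "1 - 1 / u = (u - 1) * (1 / u)" using u0 by (simp add: field_simps)
    ultimately have "\<bar>ln u\<bar> \<le> \<bar>(u - 1) * (1 / u)\<bar>" using l2 by linarith
    then have "(ln u)\<^sup>2 \<le> ((u - 1) * (1 / u))\<^sup>2" by (simp only: abs_le_square_iff)
    also have "\<dots> = (u - 1)\<^sup>2 * (1 / u)\<^sup>2" by (simp add: power_mult_distrib power_divide)
    also have "\<dots> \<le> (u - 1)\<^sup>2 * (a / c)\<^sup>2" using uc u0 by (intro mult_left_mono power_mono) auto
    also have "\<dots> \<le> (u - 1)\<^sup>2 * (1 + (a / c)\<^sup>2)" by (intro mult_left_mono) auto
    finally show ?thesis .
  qed
  have "(ln b)\<^sup>2 - (ln a)\<^sup>2 - 2 * (ln a / a) * (b - a) = 2 * ln a * (ln u - (u - 1)) + (ln u)\<^sup>2"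
  proof -
    have "2 * (ln a / a) * (b - a) = 2 * ln a * (u - 1)" using a by (simp add: ba)
    then show ?thesis by (simp add: lnb power2_eq_square algebra_simps)
  qed
  also have "\<bar>\<dots>\<bar> \<le> 2 * \<bar>ln a\<bar> * \<bar>ln u - (u - 1)\<bar> + (ln u)\<^sup>2"
    by (intro abs_triangle_ineq[THEN order_trans]) (simp add: abs_mult)
  also have "\<dots> \<le> 2 * \<bar>ln a\<bar> * ((u - 1)\<^sup>2 * (a / c)) + (u - 1)\<^sup>2 * (1 + (a / c)\<^sup>2)"
    by (intro add_mono mult_left_mono r1 r2) auto
  also have "\<dots> = (b - a)\<^sup>2 * ((2 * \<bar>ln a\<bar> * (a / c) + 1 + (a / c)\<^sup>2) / a\<^sup>2)"
  proof -
    have "(b - a)\<^sup>2 * (x / a\<^sup>2) = (u - 1)\<^sup>2 * x" for x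
      using a by (simp add: ba power_mult_distrib)
    then show ?thesis by (simp only:) (simp add: algebra_simps)
  qed
  finally show ?thesis .
qed

text \<open>The squared norm is the trace of \<open>ln\<close> squared, whose gradient is
  \<open>2 ln x / x\<close> evaluated at \<open>A\<close>, as in the commutative case. In the
  weights of the pair \<open>A\<close>, \<open>B\<close> the remainder is a sum of scalar Taylor
  remainders, hence at most a constant times the squared norm of \<open>B - A\<close>.\<close>

lemma has_derivative_norm_matrix_ln_squared:
  fixes A :: "complex^'n^'n"
  assumes A: "A \<in> pd_matrices"
  shows "((\<lambda>X. (norm (matrix_ln X))\<^sup>2) has_derivative
    (\<lambda>D. 2 * (hermitian_fun (\<lambda>x. ln x / x) A \<bullet> D))) (at A within pd_matrices)"
proof -
  have hA: "hermitian A" by (rule pd_hermitian[OF A])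
  obtain U a where U: "unitary U" and Ad: "A = U ** real_diag a ** adj U" and a: "\<forall>i. 0 < a $ i"
    using pd_spectral[OF A] .
  obtain c0 where c0: "c0 > 0" "\<forall>x. c0 * (norm x)\<^sup>2 \<le> x \<bullet> (A *v x)"
    using pd_lower_bound[OF A] .
  define c where "c = c0 / 2"
  have c: "c > 0" "2 * c * (norm x)\<^sup>2 \<le> x \<bullet> (A *v x)" for x
    using c0(1) c0(2)[rule_format, of x] by (simp_all add: c_def)
  \<comment> \<open>\<open>\<kappa> i\<close> is the constant of \<open>ln_squared_remainder\<close>
    at the eigenvalue \<open>a $ i\<close>; since these are nonnegative, their sum \<open>K\<close>
    serves for all eigenvalues at once.\<close>
  define \<kappa> where "\<kappa> i = (2 * \<bar>ln (a $ i)\<bar> * (a $ i / c) + 1 + (a $ i / c)\<^sup>2) / (a $ i)\<^sup>2" for i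
  define K where "K = (\<Sum>i\<in>UNIV. \<kappa> i)"
  let ?P = "hermitian_fun (\<lambda>x. ln x / x) A"
  have \<kappa>0: "0 \<le> \<kappa> i" for i unfolding \<kappa>_def
    using less_imp_le[OF a[rule_format]] less_imp_le[OF c(1)]
    by (intro divide_nonneg_nonneg add_nonneg_nonneg mult_nonneg_nonneg) auto
  have bound: "\<bar>(norm (matrix_ln B))\<^sup>2 - (norm (matrix_ln A))\<^sup>2 - 2 * (?P \<bullet> (B - A))\<bar> \<le> K * (norm (B - A))\<^sup>2"
    if B: "B \<in> pd_matrices" and d: "dist B A < c" for B
  proof -
    have hB: "hermitian B" by (rule pd_hermitian[OF B])
    obtain V b w where V: "unitary V" and Bd: "B = V ** real_diag b ** adj V"
      and w0': "\<forall>i j. 0 \<le> w i j"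
      and w': "\<forall>f g. hermitian_fun f A \<bullet> hermitian_fun g B
        = (\<Sum>i\<in>UNIV. \<Sum>j\<in>UNIV. w i j * (f (a $ i) * g (b $ j)))"
      using spectral_pair[OF U Ad hB] .
    note w = w'[rule_format] and w0 = w0'[rule_format]
    have "norm (B - A) \<le> c" using d by (simp add: dist_norm)
    note bl = pd_perturb_lower_bound[OF hA c(2) hB this]
    have b: "c \<le> b $ i" for i using bl quadratic_ge_iff[OF V, of c b] by (simp add: Bd)
    define p where "p i = ln (a $ i) / a $ i" for i
    define r where "r i j = (ln (b $ j))\<^sup>2 - (ln (a $ i))\<^sup>2 - 2 * p i * (b $ j - a $ i)" for i j
    have t1: "(norm (matrix_ln B))\<^sup>2 = (\<Sum>i\<in>UNIV. \<Sum>j\<in>UNIV. w i j * (ln (b $ j))\<^sup>2)"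
      unfolding power2_norm_eq_inner matrix_ln_def inner_hermitian_fun[OF hB hA]
      unfolding inner_commute[of _ "hermitian_fun (\<lambda>x. 1) A"] w by (simp add: power2_eq_square)
    have t2: "(norm (matrix_ln A))\<^sup>2 = (\<Sum>i\<in>UNIV. \<Sum>j\<in>UNIV. w i j * (ln (a $ i))\<^sup>2)"
      unfolding power2_norm_eq_inner matrix_ln_def inner_hermitian_fun[OF hA hB] w
      by (simp add: power2_eq_square)
    have t3: "?P \<bullet> B = (\<Sum>i\<in>UNIV. \<Sum>j\<in>UNIV. w i j * (p i * b $ j))"
      using w[of "\<lambda>x. ln x / x" "\<lambda>x. x"] by (simp only: hermitian_fun_id[OF hB] p_def)
    have t4: "?P \<bullet> A = (\<Sum>i\<in>UNIV. \<Sum>j\<in>UNIV. w i j * (p i * a $ i))"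
      using inner_hermitian_fun[OF hA hB, of "\<lambda>x. ln x / x" "\<lambda>x. x"]
      by (simp only: hermitian_fun_id[OF hA] w mult_1_right p_def)
    have "(norm (matrix_ln B))\<^sup>2 - (norm (matrix_ln A))\<^sup>2 - 2 * (?P \<bullet> (B - A))
        = (\<Sum>i\<in>UNIV. \<Sum>j\<in>UNIV. w i j * r i j)"
      unfolding t1 t2 t3 t4 inner_diff_right r_def
      by (simp add: sum_subtractf[symmetric] sum_distrib_left right_diff_distrib mult_ac)
    also have "\<bar>\<dots>\<bar> \<le> (\<Sum>i\<in>UNIV. \<Sum>j\<in>UNIV. \<bar>w i j * r i j\<bar>)"
      by (rule sum_abs[THEN order_trans]) (intro sum_mono sum_abs)
    also have "\<dots> \<le> (\<Sum>i\<in>UNIV. \<Sum>j\<in>UNIV. w i j * ((b $ j - a $ i)\<^sup>2 * K))"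
    proof (intro sum_mono)
      fix i j
      have "\<bar>r i j\<bar> \<le> (b $ j - a $ i)\<^sup>2 * \<kappa> i"
        using ln_squared_remainder[of "a $ i" c "b $ j"] a b c(1) by (simp add: r_def p_def \<kappa>_def)
      also have "\<dots> \<le> (b $ j - a $ i)\<^sup>2 * K"
        unfolding K_def using \<kappa>0 by (intro mult_left_mono member_le_sum) auto
      finally show "\<bar>w i j * r i j\<bar> \<le> w i j * ((b $ j - a $ i)\<^sup>2 * K)"
        using w0 by (simp add: abs_mult mult_left_mono)
    qed
    also have "\<dots> = K * (\<Sum>i\<in>UNIV. \<Sum>j\<in>UNIV. w i j * (a $ i - b $ j)\<^sup>2)"
      by (simp add: sum_distrib_left mult_ac power2_commute)
    also have "(\<Sum>i\<in>UNIV. \<Sum>j\<in>UNIV. w i j * (a $ i - b $ j)\<^sup>2) = (norm (B - A))\<^sup>2"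
      using norm_hermitian_fun_diff[OF hA hB w, of "\<lambda>x. x"]
      by (simp add: hermitian_fun_id hA hB norm_minus_commute)
    finally show ?thesis .
  qed
  show ?thesis
  proof (rule has_derivativeI_sandwich[OF c(1)])
    show "bounded_linear (\<lambda>D. 2 * (?P \<bullet> D))"
      by (intro bounded_linear_const_mult bounded_linear_inner_right)
    show "((\<lambda>X. K * norm (X - A)) \<longlongrightarrow> 0) (at A within pd_matrices)"
      by (auto intro!: tendsto_eq_intros)
    fix B assume B: "B \<in> pd_matrices" "B \<noteq> A" "dist B A < c"
    then show "norm ((norm (matrix_ln B))\<^sup>2 - (norm (matrix_ln A))\<^sup>2 - 2 * (?P \<bullet> (B - A))) / norm (B - A)
        \<le> K * norm (B - A)"
      using bound[OF B(1,3)] by (simp add: divide_le_eq power2_eq_square mult.assoc)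
  qed
qed

text \<open>Moving the base point along \<open>diag (exp (t h))\<close> and pulling it back to the
  identity by congruence sends \<open>Y\<close> to this matrix; the distance is then the norm of its
  logarithm.\<close>

definition diag_flow :: "real^'n \<Rightarrow> complex^'n^'n \<Rightarrow> real \<Rightarrow> complex^'n^'n" where
  "diag_flow h Y t = real_diag (\<chi> i. exp (- t * h $ i / 2)) ** Y ** real_diag (\<chi> i. exp (- t * h $ i / 2))"

lemma diag_flow_nth: "diag_flow h Y t $ i $ j = exp (- t * (h $ i + h $ j) / 2) *\<^sub>R Y $ i $ j"
proof -
  let ?e = "\<lambda>i. exp (- t * h $ i / 2)"
  have "diag_flow h Y t $ i $ j = complex_of_real (?e i) * Y $ i $ j * complex_of_real (?e j)"
    by (simp add: diag_flow_def real_diag_mult_nth mult_real_diag_nth)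
  also have "\<dots> = (?e i * ?e j) *\<^sub>R Y $ i $ j"
    by (simp add: scaleR_conv_of_real)
  also have "?e i * ?e j = exp (- t * (h $ i + h $ j) / 2)"
    by (simp add: exp_add[symmetric] ring_distribs add_divide_distrib)
  finally show ?thesis .
qed

lemma invertible_real_diag_exp: "invertible (real_diag (\<chi> i. exp (f i)))"
  unfolding invertible_def
  by (intro exI[of _ "real_diag (\<chi> i. exp (- f i))"]) (simp add: real_diag_mult exp_add[symmetric] real_diag_1)

lemma pd_diag_flow: "Y \<in> pd_matrices \<Longrightarrow> diag_flow h Y t \<in> pd_matrices"
  using pd_congr[OF _ invertible_real_diag_exp, of Y "\<lambda>i. - t * h $ i / 2"]
  by (simp add: diag_flow_def)

lemma diag_flow_0 [simp]: "diag_flow h Y 0 = Y"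
  by (simp add: vec_eq_iff diag_flow_nth)

lemma matrix_as_sum: "A = (\<Sum>i\<in>UNIV. \<Sum>j\<in>UNIV. axis i (axis j (A $ i $ j)))"
  for A :: "'a::comm_monoid_add^'n^'m"
proof -
  have *: "A $ k $ l = (\<Sum>i\<in>UNIV. \<Sum>j\<in>UNIV. axis i (axis j (A $ i $ j))) $ k $ l" for k l
  proof -
    have "(\<Sum>i\<in>UNIV. \<Sum>j\<in>UNIV. axis i (axis j (A $ i $ j))) $ k $ l
        = (\<Sum>i\<in>UNIV. if i = k then \<Sum>j\<in>UNIV. if j = l then A $ i $ j else 0 else 0)"
      unfolding sum_component by (intro sum.cong refl) (auto simp: axis_def intro!: sum.cong)
    then show ?thesis by simp
  qed
  show ?thesis by (intro iffD2[OF vec_eq_iff] allI *)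
qed

lemma has_vector_derivative_diag_flow:
  "(diag_flow h Y has_vector_derivative
    (- 1 / 2) *\<^sub>R (real_diag h ** diag_flow h Y t + diag_flow h Y t ** real_diag h)) (at t)"
proof -
  let ?r = "\<lambda>i j t. exp (- t * (h $ i + h $ j) / 2)"
  have flow: "diag_flow h Y = (\<lambda>t. \<Sum>i\<in>UNIV. \<Sum>j\<in>UNIV. ?r i j t *\<^sub>R axis i (axis j (Y $ i $ j)))"
  proof
    fix t
    show "diag_flow h Y t = (\<Sum>i\<in>UNIV. \<Sum>j\<in>UNIV. ?r i j t *\<^sub>R axis i (axis j (Y $ i $ j)))"
      by (subst matrix_as_sum[of "diag_flow h Y t"], intro sum.cong refl)
        (simp add: diag_flow_nth vec_eq_iff axis_def)
  qed
  have "(diag_flow h Y has_vector_derivative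
      (\<Sum>i\<in>UNIV. \<Sum>j\<in>UNIV. (- ((h $ i + h $ j) / 2) * ?r i j t) *\<^sub>R axis i (axis j (Y $ i $ j)))) (at t)"
    unfolding flow
  proof (intro has_vector_derivative_sum)
    fix i j
    have "(?r i j has_real_derivative (- ((h $ i + h $ j) / 2) * ?r i j t)) (at t)"
      by (auto intro!: derivative_eq_intros)
    from has_vector_derivative_scaleR[OF this has_vector_derivative_const]
    show "((\<lambda>t. ?r i j t *\<^sub>R axis i (axis j (Y $ i $ j))) has_vector_derivative
        (- ((h $ i + h $ j) / 2) * ?r i j t) *\<^sub>R axis i (axis j (Y $ i $ j))) (at t)"
      by simp
  qed
  also have "(\<Sum>i\<in>UNIV. \<Sum>j\<in>UNIV. (- ((h $ i + h $ j) / 2) * ?r i j t) *\<^sub>R axis i (axis j (Y $ i $ j)))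
      = (- 1 / 2) *\<^sub>R (real_diag h ** diag_flow h Y t + diag_flow h Y t ** real_diag h)" (is "_ = ?D")
    by (subst matrix_as_sum[of ?D], intro sum.cong refl)
      (simp add: diag_flow_nth vec_eq_iff axis_def real_diag_mult_nth mult_real_diag_nth,
        simp add: scaleR_conv_of_real algebra_simps)
  finally show ?thesis .
qed

text \<open>The velocity is minus half the anticommutator of \<open>real_diag h\<close> with
  \<open>?M\<close>. Paired with the gradient \<open>?P\<close>, each half can be moved across by
  cyclicity of the trace, where \<open>?P\<close> and \<open>?M\<close> multiply to the logarithm of
  \<open>?M\<close>.\<close>

lemma has_real_derivative_norm_ln_diag_flow:
  assumes Y: "Y \<in> pd_matrices"
  shows "((\<lambda>t. (norm (matrix_ln (diag_flow h Y t)))\<^sup>2) has_real_derivative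
    - 2 * (matrix_ln (diag_flow h Y t) \<bullet> real_diag h)) (at t)"
proof -
  let ?M = "diag_flow h Y t"
  let ?P = "hermitian_fun (\<lambda>x. ln x / x) ?M"
  have M: "?M \<in> pd_matrices" by (rule pd_diag_flow[OF Y])
  have hM: "hermitian ?M" by (rule pd_hermitian[OF M])
  define M' where "M' = (- 1 / 2) *\<^sub>R (real_diag h ** ?M + ?M ** real_diag h)"
  have "(diag_flow h Y has_derivative (\<lambda>s. s *\<^sub>R M')) (at t)"
    using has_vector_derivative_diag_flow unfolding M'_def has_vector_derivative_def .
  moreover have "((\<lambda>X. (norm (matrix_ln X))\<^sup>2) has_derivative (\<lambda>D. 2 * (?P \<bullet> D)))
      (at ?M within range (diag_flow h Y))"
    by (rule has_derivative_subset[OF has_derivative_norm_matrix_ln_squared[OF M]])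
      (auto intro: pd_diag_flow[OF Y])
  ultimately have D: "((\<lambda>t. (norm (matrix_ln (diag_flow h Y t)))\<^sup>2) has_derivative
      (\<lambda>s. 2 * (?P \<bullet> (s *\<^sub>R M')))) (at t)"
    by (rule has_derivative_in_compose)
  have "?P ** ?M = matrix_ln ?M" "?M ** ?P = matrix_ln ?M"
  proof -
    have "hermitian_fun (\<lambda>x. ln x / x * x) ?M = matrix_ln ?M"
      unfolding matrix_ln_def by (rule hermitian_fun_cong_pd[OF M]) simp
    moreover have "hermitian_fun (\<lambda>x. x * (ln x / x)) ?M = matrix_ln ?M"
      unfolding matrix_ln_def by (rule hermitian_fun_cong_pd[OF M]) simp
    ultimately show "?P ** ?M = matrix_ln ?M" "?M ** ?P = matrix_ln ?M"
      using hermitian_fun_mult[OF hM, of "\<lambda>x. ln x / x" "\<lambda>x. x"]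
        hermitian_fun_mult[OF hM, of "\<lambda>x. x" "\<lambda>x. ln x / x"] by (simp_all add: hermitian_fun_id[OF hM])
  qed
  then have "?P \<bullet> (real_diag h ** ?M) = matrix_ln ?M \<bullet> real_diag h"
    "?P \<bullet> (?M ** real_diag h) = matrix_ln ?M \<bullet> real_diag h"
    using inner_mult_right[of "real_diag h" ?M ?P] inner_mult_left[of ?M "real_diag h" ?P]
    by (simp_all add: hermitianD[OF hM] inner_commute)
  then have "(\<lambda>s. 2 * (?P \<bullet> (s *\<^sub>R M'))) = (*) (- 2 * (matrix_ln ?M \<bullet> real_diag h))"
    by (simp add: M'_def inner_add_right fun_eq_iff)
  with D show ?thesis unfolding has_field_derivative_def by (simp only:)
qed

subsection \<open>Triangle inequality and first variation\<close>

text \<open>By Cauchy-Schwarz the derivative of the squared norm \<open>g\<close> is at most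
  \<open>2 sqrt g\<close> times \<open>norm h\<close>, so \<open>sqrt g\<close> is Lipschitz with
  constant \<open>norm h\<close>.\<close>

lemma norm_ln_diag_flow_le:
  assumes Y: "Y \<in> pd_matrices"
  shows "\<bar>norm (matrix_ln (diag_flow h Y t)) - norm (matrix_ln Y)\<bar> \<le> \<bar>t\<bar> * norm h"
proof -
  define g where "g s = (norm (matrix_ln (diag_flow h Y s)))\<^sup>2" for s
  have g0: "0 \<le> g s" for s by (simp add: g_def)
  have gd: "(g has_real_derivative - 2 * (matrix_ln (diag_flow h Y s) \<bullet> real_diag h)) (at s)" for s
    unfolding g_def by (rule has_real_derivative_norm_ln_diag_flow[OF Y])
  \<comment> \<open>The positive shift \<open>e\<close> keeps the square root differentiable where
    \<open>g\<close> vanishes; it is removed afterwards with \<open>e = d\<^sup>2\<close> and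
    subadditivity of the root.\<close>
  have lip: "\<bar>sqrt (g t + e) - sqrt (g 0 + e)\<bar> \<le> norm h * \<bar>t\<bar>" if e: "e > 0" for e
  proof -
    define D where "D s = - (matrix_ln (diag_flow h Y s) \<bullet> real_diag h) / sqrt (g s + e)" for s
    have pos: "0 < g s + e" for s using g0[of s] e by linarith
    have "((\<lambda>s. sqrt (g s + e)) has_real_derivative D s) (at s within UNIV)" for s
      unfolding D_def using pos[of s]
      by (auto intro!: derivative_eq_intros gd simp: divide_simps)
    moreover have "norm (D s) \<le> norm h" for s
    proof -
      have "\<bar>matrix_ln (diag_flow h Y s) \<bullet> real_diag h\<bar> \<le> sqrt (g s) * norm h"
        using Cauchy_Schwarz_ineq2[of "matrix_ln (diag_flow h Y s)" "real_diag h"]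
        by (simp add: g_def norm_real_diag)
      also have "\<dots> \<le> sqrt (g s + e) * norm h"
        using e by (intro mult_right_mono) auto
      finally show ?thesis using pos[of s] by (simp add: D_def divide_le_eq mult.commute)
    qed
    ultimately show ?thesis
      using field_differentiable_bound[of UNIV "\<lambda>s. sqrt (g s + e)" D "norm h" t 0] by simp
  qed
  have le: "sqrt a \<le> sqrt b + norm h * \<bar>t\<bar>"
    if ab: "0 \<le> b" "\<And>e. e > 0 \<Longrightarrow> sqrt (a + e) - sqrt (b + e) \<le> norm h * \<bar>t\<bar>" for a b
  proof (rule field_le_epsilon)
    fix d :: real assume d: "d > 0"
    have "sqrt a \<le> sqrt (a + d\<^sup>2)" by simp
    also have "\<dots> \<le> sqrt (b + d\<^sup>2) + norm h * \<bar>t\<bar>" using ab(2)[of "d\<^sup>2"] d by simp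
    also have "sqrt (b + d\<^sup>2) \<le> sqrt b + sqrt (d\<^sup>2)" using ab(1) by (intro sqrt_add_le_add_sqrt) auto
    finally show "sqrt a \<le> sqrt b + norm h * \<bar>t\<bar> + d" using d by simp
  qed
  have "sqrt (g t) \<le> sqrt (g 0) + norm h * \<bar>t\<bar>" "sqrt (g 0) \<le> sqrt (g t) + norm h * \<bar>t\<bar>"
    using lip by (intro le g0; force simp: abs_le_iff)+
  then show ?thesis by (simp add: g_def abs_le_iff mult.commute)
qed

lemma trace_dist_eq_diag_flow:
  fixes Q :: "complex^'n^'n"
  assumes Q: "Q ** Q' = mat 1" "Q' ** Q = mat 1" and X: "X \<in> pd_matrices"
  shows "trace_dist (adj Q ** real_diag (vmap exp (t *\<^sub>R h)) ** Q) X
    = norm (matrix_ln (diag_flow h (adj Q' ** X ** Q') t))"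
proof -
  let ?E = "real_diag (\<chi> i. exp (- t * h $ i / 2))"
  have Q2: "adj Q' ** adj Q = mat 1" using adj_mult[of Q Q'] Q by simp
  have iQ: "invertible Q" using Q by (auto simp: invertible_def)
  have "adj (Q' ** ?E) ** (adj Q ** real_diag (vmap exp (t *\<^sub>R h)) ** Q) ** (Q' ** ?E)
      = ?E ** (adj Q' ** adj Q) ** real_diag (vmap exp (t *\<^sub>R h)) ** (Q ** Q') ** ?E"
    by (simp add: adj_mult matrix_mul_assoc)
  also have "\<dots> = mat 1"
    unfolding Q Q2 by (simp add: real_diag_mult exp_add[symmetric] real_diag_1)
  finally have "trace_dist (adj Q ** real_diag (vmap exp (t *\<^sub>R h)) ** Q) X
      = norm (matrix_ln (adj (Q' ** ?E) ** X ** (Q' ** ?E)))"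
    by (intro trace_dist_congr X pd_congr[OF pd_real_diag_exp iQ])
  then show ?thesis by (simp add: diag_flow_def adj_mult matrix_mul_assoc)
qed

text \<open>The base point travels from \<open>A\<close> to \<open>B\<close> along a geodesic with
  constant speed \<open>norm h\<close>, which is also the distance of the endpoints; along it the
  distance to \<open>X\<close> changes at most at that speed.\<close>

lemma trace_dist_triangle_diff:
  fixes A B X :: "complex^'n^'n"
  assumes A: "A \<in> pd_matrices" and B: "B \<in> pd_matrices" and X: "X \<in> pd_matrices"
  shows "\<bar>trace_dist B X - trace_dist A X\<bar> \<le> trace_dist A B"
proof -
  obtain Q :: "complex^'n^'n" and h where Q: "invertible Q" and Ad: "A = adj Q ** Q"
    and Bd: "B = adj Q ** real_diag (vmap exp h) ** Q"
    using simultaneous_diag[OF A B] .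
  obtain Q' where Q': "Q ** Q' = mat 1" "Q' ** Q = mat 1" using Q by (auto simp: invertible_def)
  then have iQ': "invertible Q'" by (auto simp: invertible_def)
  have A': "A = adj Q ** real_diag (vmap exp 0) ** Q" by (simp add: Ad real_diag_1)
  have "trace_dist A B = norm h"
    unfolding A' Bd using Q by (simp add: trace_dist_congruence trace_dist_diag del: zero_index)
  moreover have "trace_dist A X = norm (matrix_ln (adj Q' ** X ** Q'))"
    using trace_dist_eq_diag_flow[OF Q' X, of 0 h] by (simp add: Ad real_diag_1)
  moreover have "trace_dist B X = norm (matrix_ln (diag_flow h (adj Q' ** X ** Q') 1))"
    using trace_dist_eq_diag_flow[OF Q' X, of 1 h] by (simp add: Bd)
  ultimately show ?thesis
    using norm_ln_diag_flow_le[OF pd_congr[OF X iQ'], of h 1] by simp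
qed

lemma trace_dist_nonneg: "A \<in> pd_matrices \<Longrightarrow> B \<in> pd_matrices \<Longrightarrow> 0 \<le> trace_dist A B"
  by (simp add: trace_dist_alt)

lemma trace_dist_triangle:
  assumes "A \<in> pd_matrices" "B \<in> pd_matrices" "C \<in> pd_matrices"
  shows "trace_dist A C \<le> trace_dist A B + trace_dist B C"
  using trace_dist_triangle_diff[OF assms] by linarith

text \<open>The bound is linear in the distance to \<open>X\<close>, hence integrable under a first
  moment, and small when \<open>A\<close> is near \<open>B\<close>.\<close>

lemma trace_dist_sq_diff:
  assumes A: "A \<in> pd_matrices" and B: "B \<in> pd_matrices" and X: "X \<in> pd_matrices"
  shows "\<bar>(trace_dist A X)\<^sup>2 - (trace_dist B X)\<^sup>2\<bar>
    \<le> trace_dist A B * (2 * trace_dist B X + trace_dist A B)"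
proof -
  have d: "\<bar>trace_dist A X - trace_dist B X\<bar> \<le> trace_dist A B"
    using trace_dist_triangle_diff[OF A B X] by (simp add: abs_minus_commute)
  have "\<bar>(trace_dist A X)\<^sup>2 - (trace_dist B X)\<^sup>2\<bar>
      = \<bar>trace_dist A X - trace_dist B X\<bar> * (trace_dist A X + trace_dist B X)"
    using trace_dist_nonneg[OF A X] trace_dist_nonneg[OF B X]
    by (simp add: power2_eq_square square_diff_square_factored abs_mult mult.commute)
  also have "\<dots> \<le> trace_dist A B * (2 * trace_dist B X + trace_dist A B)"
    using d trace_dist_nonneg[OF A X] trace_dist_nonneg[OF B X] by (intro mult_mono) auto
  finally show ?thesis .
qed

text \<open>The tangent vector at \<open>Z\<close> pointing to \<open>X\<close>, transported to the
  identity: the outer square roots of the logarithm at \<open>Z\<close> are left off, so that the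
  Euclidean norm of what remains is the distance.\<close>

definition rel_log :: "complex^'n^'n \<Rightarrow> complex^'n^'n \<Rightarrow> complex^'n^'n" where
  "rel_log Z X = matrix_ln (isqrt_mat Z ** X ** isqrt_mat Z)"

lemma pd_isqrt_congr:
  assumes "Z \<in> pd_matrices" "X \<in> pd_matrices"
  shows "isqrt_mat Z ** X ** isqrt_mat Z \<in> pd_matrices"
  using pd_congr[OF assms(2) sqrt_mat(7)[OF assms(1)]] sqrt_mat(1)[OF assms(1)]
  by (simp add: hermitianD)

lemma trace_dist_rel_log:
  "Z \<in> pd_matrices \<Longrightarrow> X \<in> pd_matrices \<Longrightarrow> trace_dist Z X = norm (rel_log Z X)"
  by (simp add: trace_dist_alt rel_log_def)

lemma mult_add_left: "(A + B) ** C = A ** C + B ** C"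
  for A B :: "complex^'n^'m"
  by (simp add: vec_eq_iff matrix_matrix_mult_def algebra_simps sum.distrib)

lemma continuous_on_congr: "continuous_on S (\<lambda>X::complex^'n^'n. A ** X ** B)"
proof -
  have "linear (\<lambda>X::complex^'n^'n. A ** X ** B)"
    by (intro linearI) (simp_all add: mult_add_left matrix_add_ldistrib mult_scaleR_left mult_scaleR_right)
  then show ?thesis by (simp add: linear_continuous_on linear_conv_bounded_linear)
qed

lemma continuous_on_rel_log:
  assumes "Z \<in> pd_matrices"
  shows "continuous_on pd_matrices (rel_log Z)"
  unfolding rel_log_def
  by (rule continuous_on_compose2[OF continuous_on_matrix_ln continuous_on_congr])
    (use pd_isqrt_congr[OF assms] in auto)

lemma continuous_on_trace_dist:
  assumes "Z \<in> pd_matrices"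
  shows "continuous_on pd_matrices (trace_dist Z)"
proof -
  have "continuous_on pd_matrices (\<lambda>X. norm (rel_log Z X))"
    by (intro continuous_on_norm continuous_on_rel_log assms)
  then show ?thesis
    by (rule continuous_on_eq) (simp add: trace_dist_rel_log assms)
qed

text \<open>The curve is
  \<open>Z\<^sup>1\<^sup>/\<^sup>2 exp(t H) Z\<^sup>1\<^sup>/\<^sup>2\<close>, written with an
  eigenbasis of \<open>H\<close> so that it becomes a diagonal flow. Its exact distance from
  \<open>Z\<close> is recorded because it supplies the domination when difference quotients are
  integrated.\<close>

lemma trace_dist_first_variation:
  fixes Z H :: "complex^'n^'n"
  assumes Z: "Z \<in> pd_matrices" and H: "hermitian H"
  obtains \<gamma> where "\<forall>t. \<gamma> t \<in> pd_matrices" "\<gamma> 0 = Z" "\<forall>t. trace_dist (\<gamma> t) Z = \<bar>t\<bar> * norm H"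
    "\<forall>X\<in>pd_matrices.
      ((\<lambda>t. (trace_dist (\<gamma> t) X)\<^sup>2) has_real_derivative - 2 * (rel_log Z X \<bullet> H)) (at 0)"
proof -
  obtain U h where U: "unitary U" and Hd: "H = U ** real_diag h ** adj U"
    using hermitian_spectral[OF H] .
  have nH: "norm H = norm h"
    using U by (simp add: Hd norm_unitary_left norm_unitary_right unitary_adj norm_real_diag)
  note R = sqrt_mat[OF Z]
  define Q where "Q = adj U ** sqrt_mat Z"
  define Q' where "Q' = isqrt_mat Z ** U"
  have QQ': "Q ** Q' = adj U ** (sqrt_mat Z ** isqrt_mat Z) ** U"
    "Q' ** Q = isqrt_mat Z ** (U ** adj U) ** sqrt_mat Z"
    by (simp_all add: Q_def Q'_def matrix_mul_assoc)
  then have Q: "Q ** Q' = mat 1" "Q' ** Q = mat 1" by (simp_all add: R unitaryD[OF U])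
  then have iQ: "invertible Q" by (auto simp: invertible_def)
  have Z_eq: "adj Q ** Q = Z"
  proof -
    have "adj Q ** Q = sqrt_mat Z ** (U ** adj U) ** sqrt_mat Z"
      by (simp add: Q_def adj_mult hermitianD[OF R(2)] matrix_mul_assoc)
    then show ?thesis by (simp add: R unitaryD[OF U])
  qed
  define \<gamma> where "\<gamma> t = adj Q ** real_diag (vmap exp (t *\<^sub>R h)) ** Q" for t
  have Z': "Z = adj Q ** real_diag (vmap exp 0) ** Q" by (simp add: Z_eq real_diag_1)
  show ?thesis
  proof (rule that[of \<gamma>]; (intro allI ballI)?)
    show "\<gamma> t \<in> pd_matrices" for t unfolding \<gamma>_def by (intro pd_congr pd_real_diag_exp iQ)
    show "\<gamma> 0 = Z" by (simp add: \<gamma>_def Z_eq real_diag_1)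
    show "trace_dist (\<gamma> t) Z = \<bar>t\<bar> * norm H" for t
      unfolding \<gamma>_def Z' using iQ
      by (simp add: trace_dist_congruence trace_dist_diag nH del: zero_index vector_scaleR_component)
    fix X :: "complex^'n^'n" assume X: "X \<in> pd_matrices"
    let ?N = "isqrt_mat Z ** X ** isqrt_mat Z"
    have N: "?N \<in> pd_matrices" by (rule pd_isqrt_congr[OF Z X])
    have Y: "adj Q' ** X ** Q' = adj U ** ?N ** U"
      by (simp add: Q'_def adj_mult hermitianD[OF R(1)] matrix_mul_assoc)
    have iU: "invertible U" using U by (auto simp: invertible_def unitary_def)
    have dist: "trace_dist (\<gamma> t) X = norm (matrix_ln (diag_flow h (adj U ** ?N ** U) t))" for t
      unfolding \<gamma>_def Y[symmetric] by (rule trace_dist_eq_diag_flow[OF Q X])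
    have "((\<lambda>t. (trace_dist (\<gamma> t) X)\<^sup>2) has_real_derivative
        - 2 * (matrix_ln (adj U ** ?N ** U) \<bullet> real_diag h)) (at 0)"
      using has_real_derivative_norm_ln_diag_flow[OF pd_congr[OF N iU], of h 0]
      by (simp add: dist)
    also have "matrix_ln (adj U ** ?N ** U) \<bullet> real_diag h = rel_log Z X \<bullet> H"
    proof -
      have "matrix_ln (adj U ** ?N ** U) = adj U ** rel_log Z X ** U"
        unfolding matrix_ln_def rel_log_def
        by (rule hermitian_fun_unitary_conj[OF pd_hermitian[OF N] U])
      then show ?thesis
        by (simp add: Hd inner_mult_right[of "adj U ** rel_log Z X"] inner_mult_left[of "adj U"] matrix_mul_assoc)
    qed
    finally show "((\<lambda>t. (trace_dist (\<gamma> t) X)\<^sup>2) has_real_derivative - 2 * (rel_log Z X \<bullet> H)) (at 0)" .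
  qed
qed

subsection \<open>Monotonicity of the relative logarithm\<close>

lemma inner_unitary_vec: "unitary U \<Longrightarrow> (U *v x) \<bullet> (U *v y) = x \<bullet> y"
  by (simp add: inner_adj[of "U *v x" U] matrix_vector_mul_assoc unitaryD)

lemma ln_has_integral:
  fixes x :: real
  assumes x: "0 < x"
  shows "((\<lambda>s. (x - 1) / (1 + s * (x - 1))) has_integral ln x) {0..1}"
proof -
  have pos: "0 < 1 + s * (x - 1)" if "s \<in> {0..1}" for s
  proof (cases "s = 1")
    case False
    then have "0 < (1 - s) + s * x" using that x by (intro add_pos_nonneg) auto
    then show ?thesis by (simp add: algebra_simps)
  qed (use x in simp)
  have "((\<lambda>s. (x - 1) / (1 + s * (x - 1))) has_integral ln (1 + 1 * (x - 1)) - ln (1 + 0 * (x - 1))) {0..1}"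
  proof (rule fundamental_theorem_of_calculus)
    fix s :: real assume "s \<in> {0..1}"
    from pos[OF this]
    have "((\<lambda>s. ln (1 + s * (x - 1))) has_real_derivative (x - 1) / (1 + s * (x - 1))) (at s within {0..1})"
      by (auto intro!: derivative_eq_intros)
    then show "((\<lambda>s. ln (1 + s * (x - 1))) has_vector_derivative (x - 1) / (1 + s * (x - 1))) (at s within {0..1})"
      by (simp only: has_real_derivative_iff_has_vector_derivative)
  qed simp
  then show ?thesis by simp
qed

text \<open>Placing the square roots of \<open>Z\<close> on \<open>y\<close> restores the outer
  factors that \<open>rel_log\<close> omits: this is the quadratic form at \<open>y\<close> of the
  full logarithm at \<open>Z\<close>.\<close>

definition rel_log_form :: "complex^'n^'n \<Rightarrow> complex^'n^'n \<Rightarrow> complex^'n \<Rightarrow> real" where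
  "rel_log_form Z X y = (sqrt_mat Z *v y) \<bullet> (rel_log Z X *v (sqrt_mat Z *v y))"

text \<open>For Hermitian \<open>Z\<close> this is the form of \<open>Z\<close> at
  \<open>y - w\<close> plus \<open>s\<close> times the form of \<open>X - Z\<close> at
  \<open>w\<close>. It is expanded so that \<open>y\<close> meets \<open>Z\<close> only through
  \<open>Z *v y\<close>, and all other coefficients are nonnegative for \<open>s\<close> between 0
  and 1.\<close>

definition resolvent_form :: "real \<Rightarrow> complex^'n^'n \<Rightarrow> complex^'n^'n \<Rightarrow> complex^'n \<Rightarrow> complex^'n \<Rightarrow> real" where
  "resolvent_form s Z X y w
    = y \<bullet> (Z *v y) - 2 * (w \<bullet> (Z *v y)) + (1 - s) * (w \<bullet> (Z *v w)) + s * (w \<bullet> (X *v w))"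

text \<open>From \<open>ln x = \<integral>\<^sub>0\<^sup>1 (x - 1)/(1 + s(x - 1)) ds\<close>: the integrand, multiplied by \<open>s\<close>, is
  \<open>1 - 1/((1 - s) + s x)\<close>, and the inverse has the usual variational description.  The minimised
  form is affine in \<open>(Z, X)\<close>, which makes order comparisons of the logarithm immediate.\<close>

lemma rel_log_form_variational:
  fixes Z X :: "complex^'n^'n"
  assumes Z: "Z \<in> pd_matrices" and X: "X \<in> pd_matrices"
  obtains f where "(f has_integral rel_log_form Z X y) {0..1}"
    "\<forall>s\<in>{0<..1}. (\<forall>w. s * f s \<le> resolvent_form s Z X y w) \<and> (\<exists>w. s * f s = resolvent_form s Z X y w)"
proof -
  let ?S = "isqrt_mat Z" and ?R = "sqrt_mat Z"
  note R = sqrt_mat[OF Z]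
  define N where "N = ?S ** X ** ?S"
  have N: "N \<in> pd_matrices" unfolding N_def by (rule pd_isqrt_congr[OF Z X])
  obtain U d where U: "unitary U" and Nd: "N = U ** real_diag d ** adj U" and d: "\<forall>i. 0 < d $ i"
    using pd_spectral[OF N] .
  \<comment> \<open>In an eigenbasis of \<open>N\<close>, \<open>a\<close> holds the coordinates of
    \<open>sqrt_mat Z *v y\<close>, and \<open>\<tau> s i\<close> is an eigenvalue of
    \<open>(1 - s) 1 + s N\<close>.\<close>
  define a where "a = adj U *v (?R *v y)"
  define \<tau> where "\<tau> s i = 1 + s * (d $ i - 1)" for s i
  define f where "f s = (\<Sum>i\<in>UNIV. (d $ i - 1) / \<tau> s i * (norm (a $ i))\<^sup>2)" for s
  have "rel_log_form Z X y = (\<Sum>i\<in>UNIV. ln (d $ i) * (norm (a $ i))\<^sup>2)"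
    unfolding rel_log_form_def rel_log_def N_def[symmetric] matrix_ln_def
    unfolding Nd hermitian_fun_diag[OF U] quadratic_diag a_def by simp
  moreover have "(f has_integral (\<Sum>i\<in>UNIV. ln (d $ i) * (norm (a $ i))\<^sup>2)) {0..1}"
    unfolding f_def \<tau>_def
    by (intro has_integral_sum has_integral_mult_left ln_has_integral) (use d in auto)
  ultimately have int: "(f has_integral rel_log_form Z X y) {0..1}" by simp
  have RNR: "?R ** N ** ?R = X"
  proof -
    have "?R ** N ** ?R = (?R ** ?S) ** X ** (?S ** ?R)" by (simp add: N_def matrix_mul_assoc)
    then show ?thesis by (simp add: R)
  qed
  have RR: "x \<bullet> (?R ** ?R *v z) = (adj U *v (?R *v x)) \<bullet> (adj U *v (?R *v z))" for x z
  proof -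
    have "(adj U *v (?R *v x)) \<bullet> (adj U *v (?R *v z)) = (?R *v x) \<bullet> (?R *v z)"
      by (rule inner_unitary_vec[OF unitary_adj[OF U]])
    also have "\<dots> = x \<bullet> (?R *v (?R *v z))" by (rule hermitian_inner[OF R(2), symmetric])
    finally show ?thesis by (simp add: matrix_vector_mul_assoc)
  qed
  have q: "resolvent_form s Z X y w
      = (\<Sum>i\<in>UNIV. (norm (a $ i))\<^sup>2 - 2 * (b $ i \<bullet> a $ i) + \<tau> s i * (norm (b $ i))\<^sup>2)"
    if b: "b = adj U *v (?R *v w)" for s w b
  proof -
    have "w \<bullet> (X *v w) = (?R *v w) \<bullet> (N *v (?R *v w))"
      by (subst RNR[symmetric]) (simp add: matrix_vector_mul_assoc[symmetric] hermitian_inner[OF R(2)])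
    also have "\<dots> = (\<Sum>i\<in>UNIV. d $ i * (norm (b $ i))\<^sup>2)"
      unfolding Nd quadratic_diag b ..
    finally have X': "w \<bullet> (X *v w) = (\<Sum>i\<in>UNIV. d $ i * (norm (b $ i))\<^sup>2)" .
    have Z': "y \<bullet> (Z *v y) = a \<bullet> a" "w \<bullet> (Z *v y) = b \<bullet> a" "w \<bullet> (Z *v w) = b \<bullet> b"
      using RR[of y y] RR[of w y] RR[of w w] by (simp_all only: R(5) a_def b)
    show ?thesis
      unfolding resolvent_form_def X' Z'
      unfolding inner_vec_def \<tau>_def
      by (simp add: sum_distrib_left sum.distrib sum_subtractf power2_norm_eq_inner algebra_simps)
  qed
  have main: "(\<forall>w. s * f s \<le> resolvent_form s Z X y w) \<and> (\<exists>w. s * f s = resolvent_form s Z X y w)"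
    if s: "s \<in> {0<..1}" for s
  proof -
    have \<tau>: "0 < \<tau> s i" for i
    proof -
      have "0 < (1 - s) + s * d $ i" using s d by (intro add_nonneg_pos) auto
      then show ?thesis by (simp add: \<tau>_def algebra_simps)
    qed
    \<comment> \<open>Completing the square in each coordinate shows that the gap vanishes exactly
      when \<open>b $ i\<close> is \<open>a $ i\<close> divided by
      \<open>\<tau> s i\<close>.\<close>
    have diff: "resolvent_form s Z X y w - s * f s
        = (\<Sum>i\<in>UNIV. (norm (a $ i - \<tau> s i *\<^sub>R b $ i))\<^sup>2 / \<tau> s i)"
      if b: "b = adj U *v (?R *v w)" for w b
    proof -
      have "(norm (a $ i))\<^sup>2 - 2 * (b $ i \<bullet> a $ i) + \<tau> s i * (norm (b $ i))\<^sup>2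
          - s * ((d $ i - 1) / \<tau> s i * (norm (a $ i))\<^sup>2)
          = (norm (a $ i - \<tau> s i *\<^sub>R b $ i))\<^sup>2 / \<tau> s i" for i
      proof -
        have e1: "s * ((d $ i - 1) / \<tau> s i * (norm (a $ i))\<^sup>2) = (norm (a $ i))\<^sup>2 - (norm (a $ i))\<^sup>2 / \<tau> s i"
          using \<tau>[of i] by (simp add: divide_simps) (simp add: \<tau>_def algebra_simps)
        have e2: "(norm (a $ i - \<tau> s i *\<^sub>R b $ i))\<^sup>2
            = (norm (a $ i))\<^sup>2 - 2 * \<tau> s i * (b $ i \<bullet> a $ i) + (\<tau> s i)\<^sup>2 * (norm (b $ i))\<^sup>2"
          unfolding power2_norm_eq_inner
          by (simp add: inner_diff inner_commute[of "a $ i" "b $ i"] power2_eq_square algebra_simps)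
        show ?thesis
          unfolding e1 e2 using \<tau>[of i]
          by (simp add: add_divide_distrib diff_divide_distrib) (simp add: power2_eq_square)
      qed
      then show ?thesis
        unfolding q[OF b] f_def by (simp only: sum_distrib_left sum_subtractf[symmetric])
    qed
    have "s * f s \<le> resolvent_form s Z X y w" for w
    proof -
      have "0 \<le> resolvent_form s Z X y w - s * f s"
        unfolding diff[OF refl] using \<tau> by (intro sum_nonneg divide_nonneg_pos) auto
      then show ?thesis by simp
    qed
    moreover have "\<exists>w. s * f s = resolvent_form s Z X y w"
    proof -
      define b where "b = (\<chi> i. (1 / \<tau> s i) *\<^sub>R a $ i)"
      \<comment> \<open>The minimiser in eigencoordinates, carried back by the inverse of
        \<open>adj U ** sqrt_mat Z\<close>.\<close>
      define w where "w = ?S *v (U *v b)"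
      have "adj U *v (?R *v w) = (adj U ** ((?R ** ?S) ** U)) *v b"
        by (simp add: w_def matrix_vector_mul_assoc matrix_mul_assoc)
      then have b: "b = adj U *v (?R *v w)" by (simp add: R unitaryD[OF U])
      have "\<tau> s i *\<^sub>R b $ i = a $ i" for i using \<tau>[of i] by (simp add: b_def)
      then have "resolvent_form s Z X y w - s * f s = 0" unfolding diff[OF b] by simp
      then show ?thesis by (intro exI[of _ w]) simp
    qed
    ultimately show ?thesis by blast
  qed
  show ?thesis using that[OF int] main by blast
qed

lemma rel_log_form_mono:
  fixes Z X Z' X' :: "complex^'n^'n"
  assumes Z: "Z \<in> pd_matrices" "X \<in> pd_matrices" "Z' \<in> pd_matrices" "X' \<in> pd_matrices"
    and le: "\<And>s w. s \<in> {0<..1} \<Longrightarrow> resolvent_form s Z X y w \<le> resolvent_form s Z' X' y' w"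
  shows "rel_log_form Z X y \<le> rel_log_form Z' X' y'"
proof -
  obtain f where f: "(f has_integral rel_log_form Z X y) {0..1}"
    and f': "\<forall>s\<in>{0<..1}. (\<forall>w. s * f s \<le> resolvent_form s Z X y w) \<and> (\<exists>w. s * f s = resolvent_form s Z X y w)"
    using rel_log_form_variational[OF Z(1,2)] .
  obtain g where g: "(g has_integral rel_log_form Z' X' y') {0..1}"
    and g': "\<forall>s\<in>{0<..1}. (\<forall>w. s * g s \<le> resolvent_form s Z' X' y' w) \<and> (\<exists>w. s * g s = resolvent_form s Z' X' y' w)"
    using rel_log_form_variational[OF Z(3,4)] .
  \<comment> \<open>At \<open>s = 0\<close> the description of \<open>s * f s\<close> says nothing
    about \<open>f 0\<close>; changing one value of the integrand leaves the integral
    unchanged.\<close>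
  have f0: "((\<lambda>s. if s = 0 then g 0 else f s) has_integral rel_log_form Z X y) {0..1}"
    by (rule has_integral_spike_finite[OF _ _ f, of "{0}"]) auto
  show ?thesis
  proof (rule has_integral_le[OF f0 g])
    fix s :: real assume s: "s \<in> {0..1}"
    show "(if s = 0 then g 0 else f s) \<le> g s"
    proof (cases "s = 0")
      case False
      then have s': "s \<in> {0<..1}" using s by auto
      then obtain w where w: "s * g s = resolvent_form s Z' X' y' w" using g' by blast
      have "s * f s \<le> resolvent_form s Z X y w" using f' s' by blast
      also have "\<dots> \<le> s * g s" using le[OF s'] w by simp
      finally show ?thesis using s' by simp
    qed simp
  qed
qed

lemma loewner_le_inner: "loewner_le A B \<Longrightarrow> x \<bullet> (A *v x) \<le> x \<bullet> (B *v x)"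
  by (simp add: loewner_le_def psd_def matrix_vector_mult_diff_rdistrib inner_diff_right)

lemma rel_log_form_mono_right:
  assumes "Z \<in> pd_matrices" "X \<in> pd_matrices" "X' \<in> pd_matrices" "loewner_le X X'"
  shows "rel_log_form Z X y \<le> rel_log_form Z X' y"
proof (rule rel_log_form_mono)
  fix s :: real and w assume "s \<in> {0<..1}"
  then show "resolvent_form s Z X y w \<le> resolvent_form s Z X' y w"
    using loewner_le_inner[OF assms(4), of w] by (simp add: resolvent_form_def mult_left_mono)
qed (use assms in auto)

text \<open>The map \<open>Z \<mapsto> log\<^sub>Z X\<close> is not monotone, but it satisfies Kamke's condition: it is monotone on
  vectors on which the two base points agree.\<close>

lemma rel_log_form_kamke:
  assumes "Z \<in> pd_matrices" "Y \<in> pd_matrices" "X \<in> pd_matrices" "loewner_le Z Y"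
    and eq: "Z *v y = Y *v y"
  shows "rel_log_form Z X y \<le> rel_log_form Y X y"
proof (rule rel_log_form_mono)
  fix s :: real and w assume "s \<in> {0<..1}"
  then show "resolvent_form s Z X y w \<le> resolvent_form s Y X y w"
    using loewner_le_inner[OF assms(4), of w] by (simp add: resolvent_form_def mult_left_mono eq)
qed (use assms in auto)

section \<open>Scaling of the base point\<close>

lemma hermitian_fun_scaleR:
  assumes "hermitian A"
  shows "hermitian_fun f (c *\<^sub>R A) = hermitian_fun (\<lambda>x. f (c * x)) A"
proof -
  obtain U d where U: "unitary U" and A: "A = U ** real_diag d ** adj U"
    using hermitian_spectral[OF assms] .
  have "c *\<^sub>R A = U ** real_diag (c *\<^sub>R d) ** adj U"
    by (simp add: A real_diag_scaleR[symmetric] mult_scaleR_left mult_scaleR_right)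
  then show ?thesis by (simp add: A hermitian_fun_diag[OF U])
qed

lemma scaleR_hermitian_fun:
  assumes "hermitian A"
  shows "c *\<^sub>R hermitian_fun f A = hermitian_fun (\<lambda>x. c * f x) A"
proof -
  obtain U d where U: "unitary U" and A: "A = U ** real_diag d ** adj U"
    using hermitian_spectral[OF assms] .
  have "real_diag (vmap (\<lambda>x. c * f x) d) = c *\<^sub>R real_diag (vmap f d)"
    by (simp add: real_diag_scaleR) (simp add: vec_eq_iff)
  then show ?thesis
    by (simp add: A hermitian_fun_diag[OF U] mult_scaleR_left mult_scaleR_right)
qed

lemma hermitian_fun_add:
  assumes "hermitian A"
  shows "hermitian_fun f A + hermitian_fun g A = hermitian_fun (\<lambda>x. f x + g x) A"
proof -
  obtain U d where U: "unitary U" and A: "A = U ** real_diag d ** adj U"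
    using hermitian_spectral[OF assms] .
  have "real_diag (vmap (\<lambda>x. f x + g x) d) = real_diag (vmap f d) + real_diag (vmap g d)"
    by (simp add: real_diag_add) (simp add: vec_eq_iff)
  then show ?thesis
    by (simp add: A hermitian_fun_diag[OF U] mult_add_left matrix_add_ldistrib)
qed

lemma pd_scaleR: "A \<in> pd_matrices \<Longrightarrow> 0 < c \<Longrightarrow> c *\<^sub>R A \<in> pd_matrices"
  by (simp add: pd_matrices_def hermitian_scaleR scaleR_mult_vec)

lemma matrix_powr_scaleR:
  assumes A: "A \<in> pd_matrices" and c: "0 < c"
  shows "matrix_powr (c *\<^sub>R A) p = (c powr p) *\<^sub>R matrix_powr A p"
  unfolding matrix_powr_def hermitian_fun_scaleR[OF pd_hermitian[OF A]]
    scaleR_hermitian_fun[OF pd_hermitian[OF A]]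
  by (rule hermitian_fun_cong_pd[OF A]) (use c in \<open>simp add: powr_mult\<close>)

lemma matrix_ln_scaleR:
  assumes A: "A \<in> pd_matrices" and c: "0 < c"
  shows "matrix_ln (c *\<^sub>R A) = matrix_ln A + ln c *\<^sub>R mat 1"
proof -
  note h = pd_hermitian[OF A]
  have "matrix_ln A + ln c *\<^sub>R mat 1 = hermitian_fun (\<lambda>x. ln x + ln c * 1) A"
    by (simp only: matrix_ln_def hermitian_fun_1[OF h, symmetric] scaleR_hermitian_fun[OF h] hermitian_fun_add[OF h])
  then show ?thesis
    unfolding matrix_ln_def hermitian_fun_scaleR[OF h]
    by (simp only:) (rule hermitian_fun_cong_pd[OF A], use c in \<open>simp add: ln_mult\<close>)
qed

text \<open>The outer square roots contribute the factor \<open>c\<close>, the inner inverse ones a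
  shift of the logarithm by \<open>- ln c\<close>. For \<open>c > 1\<close> the shift gives a
  strictly negative term at every nonzero \<open>y\<close>.\<close>

lemma rel_log_form_scaleR:
  assumes Z: "Z \<in> pd_matrices" and X: "X \<in> pd_matrices" and c: "0 < c"
  shows "rel_log_form (c *\<^sub>R Z) X y = c * rel_log_form Z X y - c * ln c * (y \<bullet> (Z *v y))"
proof -
  let ?N = "isqrt_mat Z ** X ** isqrt_mat Z"
  have S: "isqrt_mat (c *\<^sub>R Z) = (c powr (-1/2)) *\<^sub>R isqrt_mat Z"
    and R: "sqrt_mat (c *\<^sub>R Z) = (c powr (1/2)) *\<^sub>R sqrt_mat Z"
    by (simp_all only: isqrt_mat_def sqrt_mat_def matrix_powr_scaleR[OF Z c])
  have p: "c powr (-1/2) * c powr (-1/2) = 1 / c" "c powr (1/2) * c powr (1/2) = c"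
    using c by (simp_all add: powr_add[symmetric] powr_minus_divide)
  have "isqrt_mat (c *\<^sub>R Z) ** X ** isqrt_mat (c *\<^sub>R Z) = (1 / c) *\<^sub>R ?N"
    by (simp only: S mult_scaleR_left mult_scaleR_right scaleR_scaleR p)
  then have L: "rel_log (c *\<^sub>R Z) X = rel_log Z X - ln c *\<^sub>R mat 1"
    using matrix_ln_scaleR[OF pd_isqrt_congr[OF Z X], of "1 / c"] c by (simp add: rel_log_def ln_div)
  let ?v = "sqrt_mat Z *v y"
  have "?v \<bullet> ?v = y \<bullet> (Z *v y)"
    using hermitian_inner[OF sqrt_mat(2)[OF Z], of y ?v]
    by (simp add: matrix_vector_mul_assoc sqrt_mat(5)[OF Z])
  moreover have "rel_log_form (c *\<^sub>R Z) X y = (c powr (1/2) * c powr (1/2)) * (?v \<bullet> (rel_log Z X *v ?v) - ln c * (?v \<bullet> ?v))"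
    by (simp add: rel_log_form_def R L scaleR_mult_vec mult_vec_scaleR matrix_vector_mult_diff_rdistrib
        inner_diff_right right_diff_distrib del: powr_half_sqrt)
  ultimately show ?thesis by (simp add: p rel_log_form_def right_diff_distrib)
qed

subsection \<open>Integration against the stochastic order\<close>

text \<open>Writing the positive part of \<open>f x\<close> as the length of
  \<open>{0..<f x}\<close> and exchanging integrals gives tails with a strict inequality, which for
  continuous \<open>f\<close> are open sets.\<close>

lemma nn_integral_layer_cake:
  fixes f :: "'a \<Rightarrow> real"
  assumes "sigma_finite_measure M" and [measurable]: "f \<in> borel_measurable M"
  shows "(\<integral>\<^sup>+x. ennreal (f x) \<partial>M)
    = (\<integral>\<^sup>+t. indicator {0..} t * emeasure M {x \<in> space M. t < f x} \<partial>lborel)"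
proof -
  interpret M: sigma_finite_measure M by fact
  interpret pair_sigma_finite M lborel ..
  have "(\<integral>\<^sup>+x. ennreal (f x) \<partial>M) = (\<integral>\<^sup>+x. (\<integral>\<^sup>+t. indicator {0..<f x} t \<partial>lborel) \<partial>M)"
  proof (intro nn_integral_cong)
    fix x
    show "ennreal (f x) = (\<integral>\<^sup>+t. indicator {0..<f x} t \<partial>lborel)"
      by (cases "0 \<le> f x") (simp_all add: ennreal_neg)
  qed
  also have "\<dots> = (\<integral>\<^sup>+t. (\<integral>\<^sup>+x. indicator {0..<f x} t \<partial>M) \<partial>lborel)"
  proof (rule Fubini'[symmetric])
    have "{p \<in> space (M \<Otimes>\<^sub>M lborel). 0 \<le> snd p \<and> snd p < f (fst p)} \<in> sets (M \<Otimes>\<^sub>M lborel)"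
      by measurable
    then have "(\<lambda>p. indicator {p \<in> space (M \<Otimes>\<^sub>M lborel). 0 \<le> snd p \<and> snd p < f (fst p)} p :: ennreal)
        \<in> borel_measurable (M \<Otimes>\<^sub>M lborel)"
      by (rule borel_measurable_indicator)
    moreover have "(case p of (x, t) \<Rightarrow> (indicator {0..<f x} t :: ennreal))
        = indicator {p \<in> space (M \<Otimes>\<^sub>M lborel). 0 \<le> snd p \<and> snd p < f (fst p)} p"
      if "p \<in> space (M \<Otimes>\<^sub>M lborel)" for p
      using that by (auto simp: indicator_def split: prod.splits)
    ultimately show "(\<lambda>(x, t). (indicator {0..<f x} t :: ennreal)) \<in> borel_measurable (M \<Otimes>\<^sub>M lborel)"
      by (simp cong: measurable_cong)
  qed
  also have "\<dots> = (\<integral>\<^sup>+t. indicator {0..} t * emeasure M {x \<in> space M. t < f x} \<partial>lborel)"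
  proof (intro nn_integral_cong)
    fix t :: real
    have "(\<integral>\<^sup>+x. indicator {0..<f x} t \<partial>M)
        = (\<integral>\<^sup>+x. indicator {0..} t * indicator {x \<in> space M. t < f x} x \<partial>M)"
      by (intro nn_integral_cong) (auto simp: indicator_def)
    then show "(\<integral>\<^sup>+x. indicator {0..<f x} t \<partial>M) = indicator {0..} t * emeasure M {x \<in> space M. t < f x}"
      by (simp add: nn_integral_cmult)
  qed
  finally show ?thesis .
qed

text \<open>The layer cake formula needs a nonnegative function, so \<open>f\<close> is cut off
  below at \<open>-n\<close> and shifted up by \<open>n\<close>; dominated convergence removes the
  cutoff. Equal total mass cancels the shift.\<close>

lemma integral_le_if_tail_le:
  fixes f :: "'a \<Rightarrow> real"
  assumes M: "prob_space M" and N: "prob_space N"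
    and f: "integrable M f" "integrable N f"
    and tail: "\<And>t. measure M {x \<in> space M. t < f x} \<le> measure N {x \<in> space N. t < f x}"
  shows "(\<integral>x. f x \<partial>M) \<le> (\<integral>x. f x \<partial>N)"
proof -
  interpret M: prob_space M by fact
  interpret N: prob_space N by fact
  define g where "g n x = max (f x) (- real n)" for n x
  have g_int: "integrable M (g n)" "integrable N (g n)" for n
    unfolding g_def using f by (auto intro!: integrable_max)
  have g_le: "(\<integral>x. g n x \<partial>M) \<le> (\<integral>x. g n x \<partial>N)" for n
  proof -
    let ?h = "\<lambda>x. g n x + real n"
    have h0: "0 \<le> ?h x" for x by (simp add: g_def)
    have h_int: "integrable M ?h" "integrable N ?h" using g_int by auto
    have tail_h: "emeasure M {x \<in> space M. t < ?h x} \<le> emeasure N {x \<in> space N. t < ?h x}"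
      if t: "0 \<le> t" for t
    proof -
      \<comment> \<open>For \<open>t \<ge> 0\<close> the points affected by the cutoff, where
        \<open>?h\<close> is zero, lie in neither set.\<close>
      have "{x \<in> A. t < ?h x} = {x \<in> A. t - real n < f x}" for A using t by (auto simp: g_def)
      then show ?thesis
        using tail[of "t - real n"] by (simp add: M.emeasure_eq_measure N.emeasure_eq_measure ennreal_leI)
    qed
    have "(\<integral>\<^sup>+x. ennreal (?h x) \<partial>M) \<le> (\<integral>\<^sup>+x. ennreal (?h x) \<partial>N)"
      unfolding nn_integral_layer_cake[OF M.sigma_finite_measure_axioms borel_measurable_integrable[OF h_int(1)]]
        nn_integral_layer_cake[OF N.sigma_finite_measure_axioms borel_measurable_integrable[OF h_int(2)]]
      by (intro nn_integral_mono) (auto simp: indicator_def tail_h)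
    then have "(\<integral>x. ?h x \<partial>M) \<le> (\<integral>x. ?h x \<partial>N)"
      using nn_integral_eq_integral[OF h_int(1)] nn_integral_eq_integral[OF h_int(2)] h0
      by (simp add: ennreal_le_iff Bochner_Integration.integral_nonneg del: Bochner_Integration.integral_add)
    then show ?thesis using g_int by (simp add: M.prob_space N.prob_space)
  qed
  have lim: "(\<lambda>n. g n x) \<longlonglongrightarrow> f x" for x
  proof (rule tendsto_eventually)
    obtain m :: nat where "- f x \<le> real m" using real_arch_simple by blast
    then have "g n x = f x" if "m \<le> n" for n
    proof -
      have "- real n \<le> f x" using that \<open>- f x \<le> real m\<close> by (simp add: order_trans[of _ "real m"])
      then show ?thesis by (simp add: g_def)
    qed
    then show "\<forall>\<^sub>F n in sequentially. g n x = f x" by (auto simp: eventually_sequentially)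
  qed
  have bound: "norm (g n x) \<le> norm (f x)" for n x by (simp add: g_def)
  have "(\<lambda>n. \<integral>x. g n x \<partial>M) \<longlonglongrightarrow> (\<integral>x. f x \<partial>M)"
    by (rule integral_dominated_convergence[where w="\<lambda>x. norm (f x)"])
      (use f g_int lim bound in auto)
  moreover have "(\<lambda>n. \<integral>x. g n x \<partial>N) \<longlonglongrightarrow> (\<integral>x. f x \<partial>N)"
    by (rule integral_dominated_convergence[where w="\<lambda>x. norm (f x)"])
      (use f g_int lim bound in auto)
  ultimately show ?thesis
    by (rule LIMSEQ_le) (use g_le in auto)
qed

lemma loewner_refl: "loewner_le A A"
  by (simp add: loewner_le_def psd_def hermitian_def vec_eq_iff)

lemma loewner_antisym:
  assumes "loewner_le A B" "loewner_le B A"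
  shows "A = B"
proof -
  let ?D = "B - A"
  have h: "hermitian ?D" and nn: "\<And>x. 0 \<le> x \<bullet> (?D *v x)"
    using assms(1) by (auto simp: loewner_le_def psd_def)
  have z: "x \<bullet> (?D *v x) = 0" for x
    using loewner_le_inner[OF assms(1), of x] loewner_le_inner[OF assms(2), of x]
    by (simp add: matrix_vector_mult_diff_rdistrib inner_diff_right)
  have "?D *v u = 0" for u
    using symmetric_psd_kernel[OF subspace_UNIV h nn _ z, of u "?D *v u"] by simp
  then have "?D = 0" by (metis matrix_eq matrix_vector_mult_0)
  then show ?thesis by simp
qed

section \<open>Integrability of the distance under a first moment\<close>

lemma P1_pdD:
  assumes "\<mu> \<in> P1_pd"
  shows "prob_space \<mu>" "space \<mu> = pd_matrices" "sets \<mu> = sets (restrict_space borel pd_matrices)"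
proof -
  show "prob_space \<mu>" and s: "sets \<mu> = sets (restrict_space borel pd_matrices)"
    using assms by (auto simp: P1_pd_def borel_prob_pd_def)
  from sets_eq_imp_space_eq[OF s] show "space \<mu> = pd_matrices" by (simp add: space_restrict_space)
qed

lemma borel_measurable_pd:
  assumes "\<mu> \<in> P1_pd" and "continuous_on pd_matrices (f :: _ \<Rightarrow> 'b::topological_space)"
  shows "f \<in> borel_measurable \<mu>"
  using borel_measurable_continuous_on_restrict[OF assms(2)]
  by (simp add: measurable_cong_sets[OF P1_pdD(3)[OF assms(1)] refl])

lemma integrable_trace_dist:
  fixes \<mu> :: "(complex^'n^'n) measure"
  assumes \<mu>: "\<mu> \<in> P1_pd" and Z: "Z \<in> pd_matrices"
  shows "integrable \<mu> (trace_dist Z)"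
proof -
  interpret prob_space \<mu> by (rule P1_pdD[OF \<mu>])
  obtain Y where Y: "Y \<in> pd_matrices" and int: "integrable \<mu> (\<lambda>X. trace_dist X Y)"
    using \<mu> by (auto simp: P1_pd_def)
  show ?thesis
  proof (rule Bochner_Integration.integrable_bound)
    show "integrable \<mu> (\<lambda>X. trace_dist Z Y + trace_dist X Y)" using int by simp
    show "trace_dist Z \<in> borel_measurable \<mu>"
      by (rule borel_measurable_pd[OF \<mu> continuous_on_trace_dist[OF Z]])
    show "AE X in \<mu>. norm (trace_dist Z X) \<le> norm (trace_dist Z Y + trace_dist X Y)"
    proof (intro AE_I2)
      fix X assume "X \<in> space \<mu>"
      then have X: "X \<in> pd_matrices" by (simp add: P1_pdD[OF \<mu>])
      show "norm (trace_dist Z X) \<le> norm (trace_dist Z Y + trace_dist X Y)"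
        using trace_dist_triangle[OF Z Y X] trace_dist_nonneg[OF Z X] trace_dist_nonneg[OF Z Y]
          trace_dist_nonneg[OF Y X] trace_dist_sym[OF X Y] by simp
    qed
  qed
qed

lemma integrable_trace_dist_sq_diff:
  fixes \<mu> :: "(complex^'n^'n) measure"
  assumes \<mu>: "\<mu> \<in> P1_pd" and Z: "Z \<in> pd_matrices" and W: "W \<in> pd_matrices"
  shows "integrable \<mu> (\<lambda>X. (trace_dist Z X)\<^sup>2 - (trace_dist W X)\<^sup>2)"
proof -
  interpret prob_space \<mu> by (rule P1_pdD[OF \<mu>])
  show ?thesis
  proof (rule Bochner_Integration.integrable_bound)
    show "integrable \<mu> (\<lambda>X. trace_dist Z W * (2 * trace_dist W X + trace_dist Z W))"
      using integrable_trace_dist[OF \<mu> W] by simp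
    show "(\<lambda>X. (trace_dist Z X)\<^sup>2 - (trace_dist W X)\<^sup>2) \<in> borel_measurable \<mu>"
      by (intro borel_measurable_pd[OF \<mu>] continuous_intros continuous_on_trace_dist Z W)
    show "AE X in \<mu>. norm ((trace_dist Z X)\<^sup>2 - (trace_dist W X)\<^sup>2)
        \<le> norm (trace_dist Z W * (2 * trace_dist W X + trace_dist Z W))"
      using trace_dist_sq_diff[OF Z W]
      by (intro AE_I2) (auto simp: P1_pdD[OF \<mu>] intro: order_trans[OF _ abs_ge_self])
  qed
qed

definition frechet_diff :: "(complex^'n^'n) measure \<Rightarrow> complex^'n^'n \<Rightarrow> complex^'n^'n \<Rightarrow> real" where
  "frechet_diff \<mu> Y Z = (\<integral>X. ((trace_dist Z X)\<^sup>2 - (trace_dist Y X)\<^sup>2) \<partial>\<mu>)"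

lemma frechet_diff_diff:
  assumes \<mu>: "\<mu> \<in> P1_pd" and "Y \<in> pd_matrices" "Z \<in> pd_matrices" "W \<in> pd_matrices"
  shows "frechet_diff \<mu> Y W - frechet_diff \<mu> Y Z = frechet_diff \<mu> Z W"
  unfolding frechet_diff_def
  using assms by (subst Bochner_Integration.integral_diff[symmetric])
    (auto intro!: integrable_trace_dist_sq_diff Bochner_Integration.integral_cong)

text \<open>Taking the candidate itself as base point eliminates the auxiliary \<open>Y\<close>; the
  cocycle identity \<open>frechet_diff_diff\<close> makes this equivalent to minimality for any
  given base point.\<close>

definition frechet_min :: "(complex^'n^'n) measure \<Rightarrow> complex^'n^'n \<Rightarrow> bool" where
  "frechet_min \<mu> Z \<longleftrightarrow> Z \<in> pd_matrices \<and> (\<forall>W\<in>pd_matrices. 0 \<le> frechet_diff \<mu> Z W)"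

lemma cartan_minimizer_iff:
  assumes "\<mu> \<in> P1_pd" "Y \<in> pd_matrices"
  shows "cartan_minimizer Y \<mu> Z \<longleftrightarrow> frechet_min \<mu> Z"
  unfolding cartan_minimizer_def frechet_min_def frechet_diff_def[symmetric]
  using frechet_diff_diff[OF assms] by (metis diff_ge_0_iff_ge)

lemma matrix_ln_1: "matrix_ln (mat 1) = 0"
proof -
  have "matrix_ln (mat 1) = real_diag (vmap ln (\<chi> i. 1))"
    unfolding real_diag_1[symmetric] matrix_ln_def by (rule hermitian_fun_real_diag)
  also have "vmap ln (\<chi> i. 1) = (0 :: real^'a)" by (simp add: vec_eq_iff)
  also have "real_diag 0 = 0" by (simp add: vec_eq_iff)
  finally show ?thesis .
qed

lemma trace_dist_self: "A \<in> pd_matrices \<Longrightarrow> trace_dist A A = 0"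
  by (simp add: trace_dist_alt sqrt_mat matrix_ln_1)

subsection \<open>The barycenter\<close>

text \<open>At a minimiser the difference quotients in direction \<open>H\<close> have nonnegative
  integrals, and dominated convergence passes this to the derivative. Positive steps yield an
  inequality; applying it also to \<open>- H\<close> yields the Karcher equation.\<close>

lemma rel_log_integral_nonpos:
  fixes \<mu> :: "(complex^'n^'n) measure"
  assumes \<mu>: "\<mu> \<in> P1_pd" and Z: "frechet_min \<mu> Z" and H: "hermitian H"
  shows "integrable \<mu> (\<lambda>X. rel_log Z X \<bullet> H)" "(\<integral>X. rel_log Z X \<bullet> H \<partial>\<mu>) \<le> 0"
proof -
  interpret prob_space \<mu> by (rule P1_pdD[OF \<mu>])
  have Zpd: "Z \<in> pd_matrices" using Z by (simp add: frechet_min_def)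
  obtain \<gamma> where \<gamma>': "\<forall>t. \<gamma> t \<in> pd_matrices" "\<gamma> 0 = Z" "\<forall>t. trace_dist (\<gamma> t) Z = \<bar>t\<bar> * norm H"
    and der: "\<forall>X\<in>pd_matrices.
      ((\<lambda>t. (trace_dist (\<gamma> t) X)\<^sup>2) has_real_derivative - 2 * (rel_log Z X \<bullet> H)) (at 0)"
    using trace_dist_first_variation[OF Zpd H] .
  note \<gamma> = \<gamma>'(1)[rule_format] \<gamma>'(2) \<gamma>'(3)[rule_format]
  define h where "h n = 1 / real (Suc n)" for n
  have h: "0 < h n" "h n \<le> 1" for n by (auto simp: h_def)
  have h_lim: "filterlim h (at 0) sequentially"
    unfolding h_def filterlim_at using lim_1_over_n LIMSEQ_Suc[of "\<lambda>n. 1 / real n" 0] by auto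
  define q where "q n X = ((trace_dist (\<gamma> (h n)) X)\<^sup>2 - (trace_dist Z X)\<^sup>2) / h n" for n X
  \<comment> \<open>The linear bound of \<open>trace_dist_sq_diff\<close> along the curve, divided
    by the step, with the remaining step replaced by its upper bound 1.\<close>
  define w where "w X = norm H * (2 * trace_dist Z X + norm H)" for X
  have q_int: "integrable \<mu> (q n)" for n
    unfolding q_def using integrable_trace_dist_sq_diff[OF \<mu> \<gamma>(1) Zpd] by simp
  have w_int: "integrable \<mu> w"
    unfolding w_def using integrable_trace_dist[OF \<mu> Zpd] by simp
  have lim: "AE X in \<mu>. (\<lambda>n. q n X) \<longlonglongrightarrow> - 2 * (rel_log Z X \<bullet> H)"
  proof (intro AE_I2)
    fix X assume "X \<in> space \<mu>"
    then have "X \<in> pd_matrices" by (simp add: P1_pdD[OF \<mu>])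
    from filterlim_compose[OF der[rule_format, OF this, unfolded has_field_derivative_iff] h_lim]
    show "(\<lambda>n. q n X) \<longlonglongrightarrow> - 2 * (rel_log Z X \<bullet> H)" by (simp add: q_def \<gamma>(2))
  qed
  have bound: "AE X in \<mu>. norm (q n X) \<le> w X" for n
  proof (intro AE_I2)
    fix X assume "X \<in> space \<mu>"
    then have X: "X \<in> pd_matrices" by (simp add: P1_pdD[OF \<mu>])
    have "\<bar>(trace_dist (\<gamma> (h n)) X)\<^sup>2 - (trace_dist Z X)\<^sup>2\<bar> \<le> h n * norm H * (2 * trace_dist Z X + h n * norm H)"
      using trace_dist_sq_diff[OF \<gamma>(1) Zpd X, of "h n"] h[of n] by (simp add: \<gamma>(3))
    also have "\<dots> \<le> h n * norm H * (2 * trace_dist Z X + norm H)"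
      using h[of n] by (intro mult_left_mono add_left_mono) (auto simp: mult_left_le_one_le)
    finally show "norm (q n X) \<le> w X"
      using h(1)[of n] by (simp add: q_def w_def divide_le_eq mult.commute mult.left_commute)
  qed
  have meas: "(\<lambda>X. - 2 * (rel_log Z X \<bullet> H)) \<in> borel_measurable \<mu>"
    by (intro borel_measurable_pd[OF \<mu>] continuous_intros continuous_on_rel_log Zpd)
  note q_meas = borel_measurable_integrable[OF q_int]
  have "integrable \<mu> (\<lambda>X. - 2 * (rel_log Z X \<bullet> H))"
    by (rule integrable_dominated_convergence[OF meas q_meas w_int lim bound])
  then show int: "integrable \<mu> (\<lambda>X. rel_log Z X \<bullet> H)" by simp
  have "(\<lambda>n. \<integral>X. q n X \<partial>\<mu>) \<longlonglongrightarrow> (\<integral>X. - 2 * (rel_log Z X \<bullet> H) \<partial>\<mu>)"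
    by (rule integral_dominated_convergence[OF meas q_meas w_int lim bound])
  moreover have "0 \<le> (\<integral>X. q n X \<partial>\<mu>)" for n
    using Z h(1)[of n] \<gamma>(1)[of "h n"] by (simp add: q_def frechet_min_def frechet_diff_def)
  ultimately have "0 \<le> (\<integral>X. - 2 * (rel_log Z X \<bullet> H) \<partial>\<mu>)"
    by (intro LIMSEQ_le_const) auto
  then show "(\<integral>X. rel_log Z X \<bullet> H \<partial>\<mu>) \<le> 0" by simp
qed

lemma karcher_equation:
  assumes \<mu>: "\<mu> \<in> P1_pd" and Z: "frechet_min \<mu> Z" and H: "hermitian H"
  shows "(\<integral>X. rel_log Z X \<bullet> H \<partial>\<mu>) = 0"
proof -
  have "hermitian (- H)" using hermitian_scaleR[OF H, of "-1"] by simp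
  from rel_log_integral_nonpos(2)[OF \<mu> Z this] rel_log_integral_nonpos(2)[OF \<mu> Z H]
  show ?thesis by simp
qed

text \<open>A quadratic form at \<open>v\<close> is the inner product with the rank-one matrix of
  \<open>v\<close> and its adjoint, so the Karcher equation can be tested vector by vector.\<close>

lemma rel_log_form_inner:
  obtains H where "hermitian H" "\<forall>X. rel_log_form Z X y = rel_log Z X \<bullet> H"
proof -
  define v where "v = sqrt_mat Z *v y"
  define H where "H = (\<chi> i j. v $ i * cnj (v $ j))"
  have "v \<bullet> (A *v v) = A \<bullet> H" for A
  proof -
    have "v \<bullet> (A *v v) = (\<Sum>i\<in>UNIV. \<Sum>j\<in>UNIV. Re (cnj (v $ i) * (A $ i $ j * v $ j)))"
      by (simp only: inner_vec_def complex_inner_Re matrix_vector_mult_def vec_lambda_beta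
          sum_distrib_left Re_sum)
    also have "\<dots> = (\<Sum>i\<in>UNIV. \<Sum>j\<in>UNIV. (A $ i $ j) \<bullet> (v $ i * cnj (v $ j)))"
      by (intro sum.cong refl) (simp add: complex_inner_Re algebra_simps)
    finally show ?thesis by (simp add: H_def inner_vec_def)
  qed
  moreover have "hermitian H" by (simp add: hermitian_def vec_eq_iff H_def)
  ultimately show ?thesis using that[of H] by (simp add: rel_log_form_def v_def)
qed

lemma integrable_rel_log_form:
  fixes \<mu> :: "(complex^'n^'n) measure"
  assumes \<mu>: "\<mu> \<in> P1_pd" and Z: "Z \<in> pd_matrices"
  shows "integrable \<mu> (\<lambda>X. rel_log_form Z X y)"
proof -
  obtain H where "hermitian H" and "\<forall>X. rel_log_form Z X y = rel_log Z X \<bullet> H"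
    using rel_log_form_inner .
  then have H: "rel_log_form Z X y = rel_log Z X \<bullet> H" for X by blast
  show ?thesis unfolding H
  proof (rule Bochner_Integration.integrable_bound)
    show "integrable \<mu> (\<lambda>X. trace_dist Z X * norm H)" using integrable_trace_dist[OF \<mu> Z] by simp
    show "(\<lambda>X. rel_log Z X \<bullet> H) \<in> borel_measurable \<mu>"
      by (intro borel_measurable_pd[OF \<mu>] continuous_intros continuous_on_rel_log Z)
    show "AE X in \<mu>. norm (rel_log Z X \<bullet> H) \<le> norm (trace_dist Z X * norm H)"
      by (intro AE_I2) (simp add: P1_pdD[OF \<mu>] trace_dist_rel_log Z Cauchy_Schwarz_ineq2 abs_mult)
  qed
qed

lemma karcher_form:
  assumes "\<mu> \<in> P1_pd" "frechet_min \<mu> Z"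
  shows "(\<integral>X. rel_log_form Z X y \<partial>\<mu>) = 0"
proof -
  obtain H where H: "hermitian H" "\<forall>X. rel_log_form Z X y = rel_log Z X \<bullet> H"
    using rel_log_form_inner .
  show ?thesis unfolding H(2)[rule_format] by (rule karcher_equation[OF assms H(1)])
qed

text \<open>Strict superlevel sets of a continuous monotone function are open upper sets, so the
  stochastic order compares the tails.\<close>

lemma stochastic_le_integral_mono:
  fixes \<mu> \<nu> :: "(complex^'n^'n) measure" and f :: "complex^'n^'n \<Rightarrow> real"
  assumes \<mu>: "\<mu> \<in> P1_pd" and \<nu>: "\<nu> \<in> P1_pd" and le: "stochastic_le \<mu> \<nu>"
    and cont: "continuous_on pd_matrices f"
    and mono: "\<And>A B. A \<in> pd_matrices \<Longrightarrow> B \<in> pd_matrices \<Longrightarrow> loewner_le A B \<Longrightarrow> f A \<le> f B"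
    and int: "integrable \<mu> f" "integrable \<nu> f"
  shows "(\<integral>X. f X \<partial>\<mu>) \<le> (\<integral>X. f X \<partial>\<nu>)"
proof (rule integral_le_if_tail_le[OF P1_pdD(1)[OF \<mu>] P1_pdD(1)[OF \<nu>] int])
  fix t
  let ?U = "{X \<in> pd_matrices. t < f X}"
  have "openin (top_of_set pd_matrices) (pd_matrices \<inter> f -` {t<..})"
    using cont by (rule continuous_openin_preimage_gen) simp
  moreover have "pd_matrices \<inter> f -` {t<..} = ?U" by auto
  ultimately have "openin (top_of_set pd_matrices) ?U" by simp
  moreover have "upper_pd_set ?U"
    unfolding upper_pd_set_def using mono loewner_refl by (auto intro: less_le_trans)
  ultimately show "measure \<mu> {X \<in> space \<mu>. t < f X} \<le> measure \<nu> {X \<in> space \<nu>. t < f X}"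
    using le by (simp add: stochastic_le_def P1_pdD[OF \<mu>] P1_pdD[OF \<nu>])
qed

text \<open>The statement concerns arbitrary minimisers instead of the barycenter, so that it can
  establish uniqueness before the definite description is resolved.\<close>

lemma frechet_min_mono:
  fixes \<mu> \<nu> :: "(complex^'n^'n) measure"
  assumes \<mu>: "\<mu> \<in> P1_pd" and \<nu>: "\<nu> \<in> P1_pd" and le: "stochastic_le \<mu> \<nu>"
    and Z: "frechet_min \<mu> Z" and W: "frechet_min \<nu> W"
  shows "loewner_le Z W"
proof (rule ccontr)
  assume nle: "\<not> loewner_le Z W"
  have pd: "Z \<in> pd_matrices" "W \<in> pd_matrices" using Z W by (auto simp: frechet_min_def)
  note herm = pd_hermitian[OF pd(1)] pd_hermitian[OF pd(2)]
  obtain x where x: "x \<bullet> (W *v x) < x \<bullet> (Z *v x)"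
    using nle herm
    by (auto simp: loewner_le_def psd_def hermitian_diff matrix_vector_mult_diff_rdistrib inner_diff_right not_le)
  then have x0: "x \<noteq> 0" by auto
  \<comment> \<open>The maximum of this generalised Rayleigh quotient is the least \<open>c\<close>
    with \<open>Z\<close> below \<open>c W\<close>, and a maximiser is the contact vector.\<close>
  define r where "r v = (v \<bullet> (Z *v v)) / (v \<bullet> (W *v v))" for v
  have W0: "v \<bullet> (W *v v) \<noteq> 0" if "v \<in> sphere 0 1" for v
    using pd_pos[OF pd(2), of v] that by fastforce
  have r_cont: "continuous_on (sphere 0 1) r"
    unfolding r_def using W0
    by (intro continuous_intros linear_continuous_on matrix_vector_mul_bounded_linear) auto
  have "(1 / norm x) *\<^sub>R x \<in> sphere 0 1" using x0 by simp
  then have "sphere (0 :: complex^'n) 1 \<noteq> {}" by blast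
  from continuous_attains_sup[OF compact_sphere this r_cont]
  obtain y where y: "y \<in> sphere 0 1" and ymax: "\<forall>v\<in>sphere 0 1. r v \<le> r y" by (rule bexE)
  have y0: "y \<noteq> 0" using y by auto
  have r_scale: "r ((1 / norm v) *\<^sub>R v) = r v" if "v \<noteq> 0" for v
    using that by (simp add: r_def mult_vec_scaleR)
  define c where "c = r y"
  have r_le: "r v \<le> c" if "v \<noteq> 0" for v
    using ymax[rule_format, of "(1 / norm v) *\<^sub>R v"] r_scale[OF that] that by (simp add: c_def)
  have "1 < r x" using x pd_pos[OF pd(2) x0] by (simp add: r_def)
  then have c: "1 < c" using r_le[OF x0] by simp
  have cW: "c *\<^sub>R W \<in> pd_matrices" using pd_scaleR[OF pd(2)] c by simp
  let ?D = "c *\<^sub>R W - Z"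
  have hD: "hermitian ?D" by (intro hermitian_diff hermitian_scaleR herm)
  have Dv: "v \<bullet> (?D *v v) = c * (v \<bullet> (W *v v)) - v \<bullet> (Z *v v)" for v
    by (simp add: matrix_vector_mult_diff_rdistrib inner_diff_right scaleR_mult_vec)
  have D0: "0 \<le> v \<bullet> (?D *v v)" for v
  proof (cases "v = 0")
    case False
    then show ?thesis using r_le[OF False] pd_pos[OF pd(2) False] by (simp add: Dv r_def divide_le_eq)
  qed simp
  have "y \<bullet> (?D *v y) = 0"
    using pd_pos[OF pd(2) y0] unfolding Dv by (simp add: c_def r_def)
  \<comment> \<open>Touching of the two forms at \<open>y\<close> is upgraded to equality of the
    image vectors, which the Kamke condition requires.\<close>
  from symmetric_psd_kernel[OF subspace_UNIV hD D0 UNIV_I this UNIV_I, of "?D *v y"]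
  have "?D *v y = 0" by simp
  then have eq: "Z *v y = (c *\<^sub>R W) *v y" by (simp add: matrix_vector_mult_diff_rdistrib)
  have "loewner_le Z (c *\<^sub>R W)" using hD D0 by (simp add: loewner_le_def psd_def)
  note kamke = rel_log_form_kamke[OF pd(1) cW _ this eq]
  interpret \<nu>: prob_space \<nu> by (rule P1_pdD[OF \<nu>])
  obtain H where "hermitian H" and "\<forall>X. rel_log_form Z X y = rel_log Z X \<bullet> H"
    using rel_log_form_inner .
  then have H: "rel_log_form Z X y = rel_log Z X \<bullet> H" for X by blast
  have cont: "continuous_on pd_matrices (\<lambda>X. rel_log_form Z X y)"
    unfolding H by (intro continuous_intros continuous_on_rel_log pd)
  have "0 = (\<integral>X. rel_log_form Z X y \<partial>\<mu>)" by (rule karcher_form[OF \<mu> Z, symmetric])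
  also have "\<dots> \<le> (\<integral>X. rel_log_form Z X y \<partial>\<nu>)"
    by (intro stochastic_le_integral_mono[OF \<mu> \<nu> le cont] rel_log_form_mono_right pd
        integrable_rel_log_form[OF \<mu> pd(1)] integrable_rel_log_form[OF \<nu> pd(1)])
  also have "\<dots> \<le> (\<integral>X. c * rel_log_form W X y - c * ln c * (y \<bullet> (W *v y)) \<partial>\<nu>)"
  proof (rule integral_mono)
    show "integrable \<nu> (\<lambda>X. rel_log_form Z X y)" by (rule integrable_rel_log_form[OF \<nu> pd(1)])
    show "integrable \<nu> (\<lambda>X. c * rel_log_form W X y - c * ln c * (y \<bullet> (W *v y)))"
      using integrable_rel_log_form[OF \<nu> pd(2)] by simp
    fix X assume "X \<in> space \<nu>"
    then have X: "X \<in> pd_matrices" by (simp add: P1_pdD[OF \<nu>])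
    show "rel_log_form Z X y \<le> c * rel_log_form W X y - c * ln c * (y \<bullet> (W *v y))"
      using kamke[OF X] rel_log_form_scaleR[OF pd(2) X, of c y] c by simp
  qed
  also have "\<dots> = - (c * ln c * (y \<bullet> (W *v y)))"
    using integrable_rel_log_form[OF \<nu> pd(2)] karcher_form[OF \<nu> W]
    by (simp add: \<nu>.prob_space)
  also have "\<dots> < 0" using c pd_pos[OF pd(2) y0] by simp
  finally show False by simp
qed

lemma stochastic_le_refl: "stochastic_le \<mu> \<mu>"
  by (simp add: stochastic_le_def)

lemma frechet_min_unique:
  assumes "\<mu> \<in> P1_pd" "frechet_min \<mu> Z" "frechet_min \<mu> W"
  shows "Z = W"
  using assms frechet_min_mono[OF assms(1,1) stochastic_le_refl] loewner_antisym by blast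

section \<open>Compactness and existence of a minimiser\<close>

lemma continuous_on_matrix_vector: "continuous_on S (\<lambda>Z::complex^'n^'n. Z *v x)"
proof -
  have "linear (\<lambda>Z::complex^'n^'n. Z *v x)"
    by (intro linearI) (simp_all add: matrix_vector_mult_add_rdistrib scaleR_mult_vec)
  then show ?thesis by (simp add: linear_continuous_on linear_conv_bounded_linear)
qed

lemma continuous_on_adj: "continuous_on S (adj :: complex^'n^'n \<Rightarrow> _)"
proof -
  have "linear (adj :: complex^'n^'n \<Rightarrow> _)"
    by (intro linearI) (simp_all add: adj_add adj_scaleR)
  then show ?thesis by (simp add: linear_continuous_on linear_conv_bounded_linear)
qed

text \<open>The cone of positive definite matrices is not closed; the uniform lower bound
  \<open>c\<close> keeps limits away from its boundary.\<close>

lemma compact_pd_bounded: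
  fixes c B :: real
  assumes c: "0 < c"
  defines "K \<equiv> {Z::complex^'n^'n. hermitian Z \<and> (\<forall>x. c * (norm x)\<^sup>2 \<le> x \<bullet> (Z *v x)) \<and> norm Z \<le> B}"
  shows "compact K" "K \<subseteq> pd_matrices"
proof -
  have K: "K = ({Z. adj Z = Z} \<inter> (\<Inter>x. {Z. c * (norm x)\<^sup>2 \<le> x \<bullet> (Z *v x)})) \<inter> cball 0 B"
    by (auto simp: K_def hermitian_def)
  have "closed ({Z::complex^'n^'n. adj Z = Z} \<inter> (\<Inter>x. {Z. c * (norm x)\<^sup>2 \<le> x \<bullet> (Z *v x)}))"
    by (intro closed_Int closed_INT ballI closed_Collect_eq closed_Collect_le continuous_intros
        continuous_on_matrix_vector continuous_on_adj)
  then show "compact K" unfolding K by (intro closed_Int_compact compact_cball)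
  show "K \<subseteq> pd_matrices" using pd_lower_boundI[OF _ c] by (auto simp: K_def)
qed

text \<open>Every eigenvalue lies between \<open>exp (- r)\<close> and \<open>exp r\<close>, so
  metric balls about the identity sit in sets that are compact for the Euclidean topology. The
  factor \<open>CARD('n)\<close> comes from bounding the norm by the sum of the absolute
  eigenvalues.\<close>

lemma pd_bounds_of_norm_ln:
  fixes Z :: "complex^'n^'n"
  assumes Z: "Z \<in> pd_matrices" and r: "norm (matrix_ln Z) \<le> r"
  shows "exp (- r) * (norm x)\<^sup>2 \<le> x \<bullet> (Z *v x)" "norm Z \<le> CARD('n) * exp r"
proof -
  obtain U d where U: "unitary U" and Zd: "Z = U ** real_diag d ** adj U" and d: "\<forall>i. 0 < d $ i"
    using pd_spectral[OF Z] .
  have nU: "norm (U ** M ** adj U) = norm M" for M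
    using U by (simp add: norm_unitary_left norm_unitary_right unitary_adj)
  have "norm (vmap ln d) \<le> r"
    using r unfolding Zd matrix_ln_def hermitian_fun_diag[OF U] nU norm_real_diag .
  then have ln_d: "\<bar>ln (d $ i)\<bar> \<le> r" for i
    using component_le_norm_cart[of "vmap ln d" i] by simp
  have "exp (- r) \<le> d $ i" for i
    using ln_d[of i] d[rule_format, of i] by (simp add: ln_ge_iff[symmetric])
  then show "exp (- r) * (norm x)\<^sup>2 \<le> x \<bullet> (Z *v x)"
    using quadratic_ge_iff[OF U, of "exp (- r)" d] by (simp add: Zd)
  have le: "\<bar>d $ i\<bar> \<le> exp r" for i
  proof -
    have "exp (ln (d $ i)) \<le> exp r" using ln_d[of i] by simp
    then show ?thesis using d[rule_format, of i] by simp
  qed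
  have "norm Z = norm d" unfolding Zd nU norm_real_diag ..
  also have "\<dots> \<le> (\<Sum>i\<in>UNIV. \<bar>d $ i\<bar>)" by (rule norm_le_l1_cart)
  also have "\<dots> \<le> (\<Sum>i\<in>(UNIV::'n set). exp r)" by (intro sum_mono le)
  finally show "norm Z \<le> CARD('n) * exp r" by simp
qed

lemma abs_frechet_diff_le:
  assumes \<mu>: "\<mu> \<in> P1_pd" and Z: "Z \<in> pd_matrices" and W: "W \<in> pd_matrices"
  shows "\<bar>frechet_diff \<mu> W Z\<bar> \<le> trace_dist Z W * (2 * (\<integral>X. trace_dist W X \<partial>\<mu>) + trace_dist Z W)"
proof -
  interpret prob_space \<mu> by (rule P1_pdD[OF \<mu>])
  have "\<bar>frechet_diff \<mu> W Z\<bar> \<le> (\<integral>X. \<bar>(trace_dist Z X)\<^sup>2 - (trace_dist W X)\<^sup>2\<bar> \<partial>\<mu>)"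
    unfolding frechet_diff_def by (rule integral_abs_bound)
  also have "\<dots> \<le> (\<integral>X. trace_dist Z W * (2 * trace_dist W X + trace_dist Z W) \<partial>\<mu>)"
    using integrable_trace_dist[OF \<mu> W] integrable_trace_dist_sq_diff[OF \<mu> Z W]
    by (intro integral_mono) (auto simp: P1_pdD[OF \<mu>] intro!: trace_dist_sq_diff Z W)
  also have "\<dots> = trace_dist Z W * (2 * (\<integral>X. trace_dist W X \<partial>\<mu>) + trace_dist Z W)"
    using integrable_trace_dist[OF \<mu> W] by (simp add: prob_space)
  finally show ?thesis .
qed

lemma continuous_on_frechet_diff:
  fixes \<mu> :: "(complex^'n^'n) measure"
  assumes \<mu>: "\<mu> \<in> P1_pd" and Y: "Y \<in> pd_matrices"
  shows "continuous_on pd_matrices (frechet_diff \<mu> Y)"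
  unfolding continuous_on_def
proof
  fix W :: "complex^'n^'n" assume W: "W \<in> pd_matrices"
  let ?F = "at W within pd_matrices"
  let ?b = "\<lambda>Z. trace_dist W Z * (2 * (\<integral>X. trace_dist W X \<partial>\<mu>) + trace_dist W Z)"
  have "(trace_dist W \<longlongrightarrow> trace_dist W W) ?F"
    using continuous_on_trace_dist[OF W] W by (simp add: continuous_on_def)
  then have d0: "(trace_dist W \<longlongrightarrow> 0) ?F" by (simp add: trace_dist_self[OF W])
  have "(?b \<longlongrightarrow> 0 * (2 * (\<integral>X. trace_dist W X \<partial>\<mu>) + 0)) ?F"
    by (intro tendsto_intros d0)
  then have b0: "(?b \<longlongrightarrow> 0) ?F" by simp
  have "\<forall>\<^sub>F Z in ?F. norm (frechet_diff \<mu> Y Z - frechet_diff \<mu> Y W) \<le> ?b Z"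
    unfolding eventually_at_topological
    using abs_frechet_diff_le[OF \<mu> _ W] frechet_diff_diff[OF \<mu> Y W]
    by (intro exI[of _ UNIV]) (auto simp: trace_dist_sym[OF W])
  from Lim_null_comparison[OF this b0]
  show "(frechet_diff \<mu> Y \<longlongrightarrow> frechet_diff \<mu> Y W) ?F" by (simp add: LIM_zero_iff)
qed

lemma frechet_min_exists:
  fixes \<mu> :: "(complex^'n^'n) measure"
  assumes \<mu>: "\<mu> \<in> P1_pd"
  obtains Z where "frechet_min \<mu> Z"
proof -
  interpret prob_space \<mu> by (rule P1_pdD[OF \<mu>])
  let ?I = "mat 1 :: complex^'n^'n"
  \<comment> \<open>The radius is twice the mean distance from the identity: at distance
    \<open>\<rho>\<close> the functional is at least \<open>\<rho> * (\<rho> - r)\<close>, by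
    integrating \<open>(\<rho> - d)\<^sup>2 - d\<^sup>2\<close> with \<open>d\<close> the distance
    from the identity to \<open>X\<close>.\<close>
  define r where "r = 2 * (\<integral>X. trace_dist ?I X \<partial>\<mu>)"
  have "0 \<le> (\<integral>X. trace_dist ?I X \<partial>\<mu>)"
    by (intro Bochner_Integration.integral_nonneg) (auto simp: P1_pdD[OF \<mu>] trace_dist_nonneg)
  then have r0: "0 \<le> r" by (simp add: r_def)
  define K where "K = {Z::complex^'n^'n. hermitian Z \<and> (\<forall>x. exp (- r) * (norm x)\<^sup>2 \<le> x \<bullet> (Z *v x))
    \<and> norm Z \<le> CARD('n) * exp r}"
  have K: "compact K" "K \<subseteq> pd_matrices"
    unfolding K_def by (rule compact_pd_bounded, simp)+
  have inK: "Z \<in> K" if "Z \<in> pd_matrices" "norm (matrix_ln Z) \<le> r" for Z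
    using pd_bounds_of_norm_ln[OF that] pd_hermitian[OF that(1)] by (simp add: K_def)
  have IK: "?I \<in> K" using r0 by (intro inK) (simp_all add: matrix_ln_1)
  have cont: "continuous_on K (frechet_diff \<mu> ?I)"
    using continuous_on_frechet_diff[OF \<mu> pd_mat1] K(2) by (rule continuous_on_subset)
  obtain Z where Z: "Z \<in> K" and min: "\<And>W. W \<in> K \<Longrightarrow> frechet_diff \<mu> ?I Z \<le> frechet_diff \<mu> ?I W"
    using continuous_attains_inf[OF K(1) _ cont] IK by blast
  have Zpd: "Z \<in> pd_matrices" using Z K(2) by blast
  have "frechet_diff \<mu> ?I ?I = 0" by (simp add: frechet_diff_def)
  then have Z0: "frechet_diff \<mu> ?I Z \<le> 0" using min[OF IK] by simp
  \<comment> \<open>\<open>K\<close> contains the metric ball of radius \<open>r\<close>, so a point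
    outside \<open>K\<close> has distance more than \<open>r\<close> from the identity and cannot
    beat the value 0 attained there.\<close>
  have outside: "0 \<le> frechet_diff \<mu> ?I W" if W: "W \<in> pd_matrices" "W \<notin> K" for W
  proof -
    define \<rho> where "\<rho> = trace_dist ?I W"
    have \<rho>: "r < \<rho>" using inK[OF W(1)] W(2) by (force simp: \<rho>_def trace_dist_1[OF W(1)])
    have "0 \<le> \<rho> * (\<rho> - r)" using \<rho> r0 by simp
    also have "\<dots> = (\<integral>X. \<rho>\<^sup>2 - 2 * \<rho> * trace_dist ?I X \<partial>\<mu>)"
      using integrable_trace_dist[OF \<mu> pd_mat1]
      by (simp add: r_def prob_space power2_eq_square algebra_simps)
    also have "\<dots> \<le> frechet_diff \<mu> ?I W"
      unfolding frechet_diff_def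
    proof (rule integral_mono)
      show "integrable \<mu> (\<lambda>X. \<rho>\<^sup>2 - 2 * \<rho> * trace_dist ?I X)"
        using integrable_trace_dist[OF \<mu> pd_mat1] by simp
      show "integrable \<mu> (\<lambda>X. (trace_dist W X)\<^sup>2 - (trace_dist ?I X)\<^sup>2)"
        by (rule integrable_trace_dist_sq_diff[OF \<mu> W(1) pd_mat1])
      fix X assume "X \<in> space \<mu>"
      then have X: "X \<in> pd_matrices" by (simp add: P1_pdD[OF \<mu>])
      have "\<bar>\<rho> - trace_dist ?I X\<bar> \<le> trace_dist W X"
        using trace_dist_triangle_diff[OF W(1) X pd_mat1]
        by (simp add: \<rho>_def trace_dist_sym[OF pd_mat1] W(1) X abs_minus_commute)
      then have "(\<rho> - trace_dist ?I X)\<^sup>2 \<le> (trace_dist W X)\<^sup>2"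
        by (metis abs_le_square_iff abs_of_nonneg trace_dist_nonneg[OF W(1) X])
      then show "\<rho>\<^sup>2 - 2 * \<rho> * trace_dist ?I X \<le> (trace_dist W X)\<^sup>2 - (trace_dist ?I X)\<^sup>2"
        by (simp add: power2_diff)
    qed
    finally show ?thesis .
  qed
  have "0 \<le> frechet_diff \<mu> Z W" if W: "W \<in> pd_matrices" for W
  proof -
    have "frechet_diff \<mu> ?I Z \<le> frechet_diff \<mu> ?I W"
      using min[of W] outside[OF W] Z0 by (cases "W \<in> K") auto
    then show ?thesis using frechet_diff_diff[OF \<mu> pd_mat1 Zpd W] by simp
  qed
  with Zpd have "frechet_min \<mu> Z" by (simp add: frechet_min_def)
  then show ?thesis by (rule that)
qed

lemma frechet_min_cartan_barycenter:
  fixes \<mu> :: "(complex^'n^'n) measure"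
  assumes \<mu>: "\<mu> \<in> P1_pd"
  shows "frechet_min \<mu> (cartan_barycenter \<mu>)"
proof -
  obtain Z where Z: "frechet_min \<mu> Z" using frechet_min_exists[OF \<mu>] .
  \<comment> \<open>The identity matrix witnesses that the quantifier over base points is not
    vacuous.\<close>
  have "(\<forall>Y\<in>pd_matrices. cartan_minimizer Y \<mu> W) \<longleftrightarrow> frechet_min \<mu> W" for W
    using cartan_minimizer_iff[OF \<mu>] pd_mat1 by blast
  then have "cartan_barycenter \<mu> = (THE W. frechet_min \<mu> W)"
    by (simp add: cartan_barycenter_def)
  also have "\<dots> = Z" using Z frechet_min_unique[OF \<mu>] by blast
  finally show ?thesis using Z by simp
qed

theorem theorem3p2:
  fixes \<mu> \<nu> :: "(complex^'n^'n) measure"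
  assumes "\<mu> \<in> P1_pd" and "\<nu> \<in> P1_pd"
    and "stochastic_le \<mu> \<nu>"
  shows "loewner_le (cartan_barycenter \<mu>) (cartan_barycenter \<nu>)"
  using frechet_min_mono[OF assms frechet_min_cartan_barycenter frechet_min_cartan_barycenter] assms
  by simp

end
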